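(* Let $\mathcal{G}=(\mathcal{V},\mathcal{E})$ be a simple connected graph with $n$ vertices and $m$ edges, and let $1\le r<n$ be a required reduction order. The following algorithm, of complexity $\mathcal{O}(mn)$, finds, if one exists, a set $\mathcal{E}_{cs}\subseteq\mathcal{E}$ with $|\mathcal{E}_{cs}|=n-r$ such that the contraction $\mathcal{G}/\!/\mathcal{E}_{cs}$ is cycle-invariant: 1. Find a spanning tree $\mathcal{T}$ of $\mathcal{G}$ and the co-tree $\mathcal{C}(\mathcal{T})$. 2. Calculate the Tucker representation $T_{(\mathcal{T},\mathcal{C})}$. 3. Choose $n-r$ edges of $\mathcal{T}$ corresponding to zero rows of $T_{(\mathcal{T},\mathcal{C})}$ to obtain $\mathcal{E}_{cs}$. Output: $\mathcal{G}_r=\mathcal{G}/\!/\mathcal{E}_{cs}$.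
   Context: Graphs are undirected. For a partition $\pi$ of $\mathcal{V}$ into cells $C_1(\pi),\dots,C_p(\pi)$, the contraction $\mathcal{G}/\!/\pi$ is the simple graph with vertex set $\{1,\dots,p\}$ in which $i\ne j$ are adjacent iff some edge of $\mathcal{G}$ joins a vertex of $C_i(\pi)$ to a vertex of $C_j(\pi)$. For $\mathcal{E}_{cs}\subseteq\mathcal{E}$, let $\pi_c(\mathcal{G},\mathcal{E}_{cs})$ be the partition of $\mathcal{V}$ into the vertex sets of the connected components of the graph $(\mathcal{V},\mathcal{E}_{cs})$, and $\mathcal{G}/\!/\mathcal{E}_{cs}:=\mathcal{G}/\!/\pi_c(\mathcal{G},\mathcal{E}_{cs})$. Cycle-invariance: a contraction $\mathcal{G}/\!/\pi$ is cycle-invariant if there is a one-to-one mapping between the set of simple cycles of $\mathcal{G}$ and the set of simple cycles of $\mathcal{G}/\!/\pi$. (A simple cycle is a path, i.e. a sequence of distinct adjacent nodes, with an additional edge such that the first and last vertices are repeated.) The co-tree $\mathcal{C}(\mathcal{T})$ is the graph obtained from $\mathcal{G}$ by removing the edges of $\mathcal{T}$. Assign an arbitrary head and tail to the end-nodes of each edge of $\mathcal{G}$. The Tucker representation $T_{(\mathcal{T},\mathcal{C})}$ is the $|\mathcal{E}(\mathcal{T})|\times|\mathcal{E}(\mathcal{C})|$ matrix whose $j$th column $t_j$ is the signed path vector of the $j$th co-tree edge $\epsilon_j$: considering the path in $\mathcal{T}$ from the head to the tail of $\epsilon_j$, $[t_j]_k=1$ if the $k$th tree edge (with its assigned head and tail)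 is along the path, $[t_j]_k=-1$ if it is opposite to the path, and $[t_j]_k=0$ otherwise. *)

theory Defs
  imports "HOL-Library.Time_Functions" "Jordan_Normal_Form.Matrix"
begin

section \<open>Graphs, simple cycles and contractions\<close>

text \<open>An undirected graph is given by its vertex set \<open>V\<close> and its edge set \<open>E\<close>, whose elements are
  two-element sets of vertices.\<close>

definition simple_graph :: "'a set \<Rightarrow> 'a set set \<Rightarrow> bool" where
  "simple_graph V E \<longleftrightarrow> finite V \<and> (\<forall>e\<in>E. e \<subseteq> V \<and> card e = 2)"

definition path :: "'a set \<Rightarrow> 'a set set \<Rightarrow> 'a list \<Rightarrow> bool" where
  "path V E p \<longleftrightarrow> p \<noteq> [] \<and> set p \<subseteq> V \<and> distinct p \<and> successively (\<lambda>u v. {u, v} \<in> E) p"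

definition linked :: "'a set \<Rightarrow> 'a set set \<Rightarrow> ('a \<times> 'a) set" where
  "linked V E = {(u, v). \<exists>p. path V E p \<and> hd p = u \<and> last p = v}"

definition connected_graph :: "'a set \<Rightarrow> 'a set set \<Rightarrow> bool" where
  "connected_graph V E \<longleftrightarrow> V \<noteq> {} \<and> V \<times> V \<subseteq> linked V E"

text \<open>Simple cycles are vertex sequences, so different starting points and directions give different
  elements. This matters for cycle-invariance: if sequences were identified up to rotation and
  reversal, contracting one edge of a 4-cycle would be cycle-invariant (one cycle before, one after),
  although every edge lies on a cycle. As sequences, there are 8 cycles before and 6 after.
  The lower bound on the length says that the closing edge is not already an edge of the path.\<close>

definition simple_cycles :: "'a set \<Rightarrow> 'a set set \<Rightarrow> 'a list set" where
  "simple_cycles V E = {p @ [hd p] | p. path V E p \<and> length p \<ge> 3 \<and> {last p, hd p} \<in> E}"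

text \<open>The contraction of \<open>(V, E)\<close> by the partition \<open>P\<close> of \<open>V\<close> is the graph \<open>(P, contract_edges P E)\<close>:
  the cells themselves serve as the vertices instead of their indices.\<close>

definition contract_edges :: "'a set set \<Rightarrow> 'a set set \<Rightarrow> 'a set set set" where
  "contract_edges P E = {{A, B} | A B. A \<in> P \<and> B \<in> P \<and> A \<noteq> B \<and> (\<exists>a\<in>A. \<exists>b\<in>B. {a, b} \<in> E)}"

definition edge_partition :: "'a set \<Rightarrow> 'a set set \<Rightarrow> 'a set set" where
  "edge_partition V F = V // linked V F"

definition cycle_invariant :: "'a set \<Rightarrow> 'a set set \<Rightarrow> 'a set set \<Rightarrow> bool" where
  "cycle_invariant V E P \<longleftrightarrow>
    (\<exists>f. bij_betw f (simple_cycles V E) (simple_cycles P (contract_edges P E)))"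

definition solution :: "'a set \<Rightarrow> 'a set set \<Rightarrow> nat \<Rightarrow> 'a set set \<Rightarrow> bool" where
  "solution V E r F \<longleftrightarrow>
    F \<subseteq> E \<and> card F = card V - r \<and> cycle_invariant V E (edge_partition V F)"

section \<open>Spanning trees and the Tucker representation\<close>

definition spanning_tree :: "'a set \<Rightarrow> 'a set set \<Rightarrow> 'a set set \<Rightarrow> bool" where
  "spanning_tree V E T \<longleftrightarrow> T \<subseteq> E \<and> connected_graph V T \<and> simple_cycles V T = {}"

definition und :: "'a \<times> 'a \<Rightarrow> 'a set" where
  "und e = {fst e, snd e}"

text \<open>A list of ordered pairs \<open>(head, tail)\<close> encodes both an enumeration of an edge set and an
  assignment of head and tail to each of its edges.\<close>

definition oriented_list :: "'a set set \<Rightarrow> ('a \<times> 'a) list \<Rightarrow> bool" where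
  "oriented_list E es \<longleftrightarrow> distinct (map und es) \<and> und ` set es = E"

definition tree_path :: "'a set \<Rightarrow> 'a set set \<Rightarrow> 'a \<Rightarrow> 'a \<Rightarrow> 'a list" where
  "tree_path V T u v = (THE p. path V T p \<and> hd p = u \<and> last p = v)"

text \<open>An edge is along a path if the path runs through it from its head to its tail, that is, in the
  same sense in which the path itself runs from the head to the tail of the co-tree edge. With this
  sign, the incidence matrices satisfy \<open>E(T) * tucker = E(C)\<close>.\<close>

definition path_sign :: "'a list \<Rightarrow> 'a \<times> 'a \<Rightarrow> int" where
  "path_sign p e =
    (if (fst e, snd e) \<in> set (zip p (tl p)) then 1
     else if (snd e, fst e) \<in> set (zip p (tl p)) then - 1
     else 0)"

definition tucker :: "'a set \<Rightarrow> ('a \<times> 'a) list \<Rightarrow> ('a \<times> 'a) list \<Rightarrow> int mat" where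
  "tucker V ts ks = mat (length ts) (length ks)
    (\<lambda>(k, j). path_sign (tree_path V (und ` set ts) (fst (ks ! j)) (snd (ks ! j))) (ts ! k))"

section \<open>The algorithm as a nondeterministic specification\<close>

definition steps_1_2 ::
  "'a set \<Rightarrow> 'a set set \<Rightarrow> ('a \<times> 'a) list \<Rightarrow> ('a \<times> 'a) list \<Rightarrow> int mat \<Rightarrow> bool" where
  "steps_1_2 V E ts ks M \<longleftrightarrow>
    (\<exists>T. spanning_tree V E T \<and> oriented_list T ts \<and> oriented_list (E - T) ks \<and> M = tucker V ts ks)"

definition step_3 :: "nat \<Rightarrow> ('a \<times> 'a) list \<Rightarrow> int mat \<Rightarrow> 'a set set \<Rightarrow> bool" where
  "step_3 q ts M F \<longleftrightarrow>
    F \<subseteq> {und (ts ! k) | k. k < dim_row M \<and> row M k = 0\<^sub>v (dim_col M)} \<and> card F = q"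

section \<open>An implementation and its running time\<close>

text \<open>\<open>reduce\<close> implements the algorithm on lists. The cost of a function \<open>f\<close> is \<open>T_f\<close>, following the
  translation scheme of \<^theory>\<open>HOL-Library.Time_Functions\<close>: every call of a recursive function costs 1
  plus the cost of evaluating its arguments and its body. Constructors, pattern matching, arithmetic
  and comparisons of numbers and of vertex names are free; the absolute values of all numbers that
  occur are at most the number of vertices.\<close>

definition represents :: "'a list \<Rightarrow> ('a \<times> 'a) list \<Rightarrow> 'a set \<Rightarrow> 'a set set \<Rightarrow> bool" where
  "represents vs es V E \<longleftrightarrow> distinct vs \<and> set vs = V \<and> oriented_list E es"

fun mem :: "'a \<Rightarrow> 'a list \<Rightarrow> bool" where
  "mem x [] = False"
| "mem x (y # ys) = (if x = y then True else mem x ys)"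

fun T_mem :: "'a \<Rightarrow> 'a list \<Rightarrow> nat" where
  "T_mem x [] = 1"
| "T_mem x (y # ys) = (if x = y then 0 else T_mem x ys) + 1"

text \<open>A partition of the vertices is a list of cells, each cell being a list of vertices.\<close>

fun cell_of :: "'a \<Rightarrow> 'a list list \<Rightarrow> 'a list" where
  "cell_of x [] = []"
| "cell_of x (c # cs) = (if mem x c then c else cell_of x cs)"

fun T_cell_of :: "'a \<Rightarrow> 'a list list \<Rightarrow> nat" where
  "T_cell_of x [] = 1"
| "T_cell_of x (c # cs) = T_mem x c + (if mem x c then 0 else T_cell_of x cs) + 1"

fun drop_cell :: "'a \<Rightarrow> 'a list list \<Rightarrow> 'a list list" where
  "drop_cell x [] = []"
| "drop_cell x (c # cs) = (if mem x c then cs else c # drop_cell x cs)"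

fun T_drop_cell :: "'a \<Rightarrow> 'a list list \<Rightarrow> nat" where
  "T_drop_cell x [] = 1"
| "T_drop_cell x (c # cs) = T_mem x c + (if mem x c then 0 else T_drop_cell x cs) + 1"

fun singletons :: "'a list \<Rightarrow> 'a list list" where
  "singletons [] = []"
| "singletons (v # vs) = [v] # singletons vs"

fun T_singletons :: "'a list \<Rightarrow> nat" where
  "T_singletons [] = 1"
| "T_singletons (v # vs) = T_singletons vs + 1"

text \<open>Growing a spanning forest: an edge joining two different cells of the current partition
  \<open>cs\<close> becomes a tree edge and merges the cells, any other edge becomes a co-tree edge.
  The resulting partition consists of the connected components.\<close>

fun sift :: "'a list list \<Rightarrow> ('a \<times> 'a) list \<Rightarrow> ('a \<times> 'a) list \<Rightarrow> ('a \<times> 'a) list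
    \<Rightarrow> ('a \<times> 'a) list \<times> ('a \<times> 'a) list \<times> 'a list list" where
  "sift cs [] ts ks = (ts, ks, cs)"
| "sift cs ((u, v) # es) ts ks =
    (let c = cell_of u cs in
     if mem v c then sift cs es ts ((u, v) # ks)
     else sift ((c @ cell_of v cs) # drop_cell u (drop_cell v cs)) es ((u, v) # ts) ks)"

fun T_sift :: "'a list list \<Rightarrow> ('a \<times> 'a) list \<Rightarrow> ('a \<times> 'a) list \<Rightarrow> ('a \<times> 'a) list \<Rightarrow> nat" where
  "T_sift cs [] ts ks = 1"
| "T_sift cs ((u, v) # es) ts ks =
    T_cell_of u cs +
    (let c = cell_of u cs in
     T_mem v c +
     (if mem v c then T_sift cs es ts ((u, v) # ks)
      else T_cell_of v cs + T_append c (cell_of v cs) +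
        (T_drop_cell v cs + T_drop_cell u (drop_cell v cs)) +
        T_sift ((c @ cell_of v cs) # drop_cell u (drop_cell v cs)) es ((u, v) # ts) ks)) + 1"

fun number :: "nat \<Rightarrow> ('a \<times> 'a) list \<Rightarrow> (nat \<times> 'a \<times> 'a) list" where
  "number k [] = []"
| "number k (e # es) = (k, e) # number (Suc k) es"

fun T_number :: "nat \<Rightarrow> ('a \<times> 'a) list \<Rightarrow> nat" where
  "T_number k [] = 1"
| "T_number k (e # es) = T_number (Suc k) es + 1"

fun zeros :: "'b list \<Rightarrow> int list" where
  "zeros [] = []"
| "zeros (e # es) = 0 # zeros es"

fun T_zeros :: "'b list \<Rightarrow> nat" where
  "T_zeros [] = 1"
| "T_zeros (e # es) = T_zeros es + 1"

fun set_at :: "nat \<Rightarrow> int \<Rightarrow> int list \<Rightarrow> int list" where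
  "set_at k s [] = []"
| "set_at 0 s (x # xs) = s # xs"
| "set_at (Suc k) s (x # xs) = x # set_at k s xs"

fun T_set_at :: "nat \<Rightarrow> int \<Rightarrow> int list \<Rightarrow> nat" where
  "T_set_at k s [] = 1"
| "T_set_at 0 s (x # xs) = 1"
| "T_set_at (Suc k) s (x # xs) = T_set_at k s xs + 1"

text \<open>\<open>traverse\<close> computes, for each vertex \<open>v\<close>, the signed path vector of the tree path from the
  root to \<open>v\<close>. \<open>work\<close> holds the vertices reached but not yet expanded, \<open>es\<close> the numbered tree
  edges not yet used. At most one vertex is expanded per element of the first argument, which
  \<open>tucker_columns\<close> sets to the vertex list. The column of a co-tree edge is the difference of two
  root path vectors, since the common part of the two root paths cancels.\<close>

fun expand :: "'a \<Rightarrow> int list \<Rightarrow> (nat \<times> 'a \<times> 'a) list \<Rightarrow> ('a \<times> int list) list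
    \<Rightarrow> (nat \<times> 'a \<times> 'a) list \<Rightarrow> ('a \<times> int list) list \<times> (nat \<times> 'a \<times> 'a) list" where
  "expand v x [] work rest = (work, rest)"
| "expand v x ((k, a, b) # es) work rest =
    (if a = v then expand v x es ((b, set_at k 1 x) # work) rest
     else if b = v then expand v x es ((a, set_at k (- 1) x) # work) rest
     else expand v x es work ((k, a, b) # rest))"

fun T_expand :: "'a \<Rightarrow> int list \<Rightarrow> (nat \<times> 'a \<times> 'a) list \<Rightarrow> ('a \<times> int list) list
    \<Rightarrow> (nat \<times> 'a \<times> 'a) list \<Rightarrow> nat" where
  "T_expand v x [] work rest = 1"
| "T_expand v x ((k, a, b) # es) work rest =
    (if a = v then T_set_at k 1 x + T_expand v x es ((b, set_at k 1 x) # work) rest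
     else if b = v then T_set_at k (- 1) x + T_expand v x es ((a, set_at k (- 1) x) # work) rest
     else T_expand v x es work ((k, a, b) # rest)) + 1"

fun traverse :: "'b list \<Rightarrow> ('a \<times> int list) list \<Rightarrow> (nat \<times> 'a \<times> 'a) list
    \<Rightarrow> ('a \<times> int list) list" where
  "traverse [] work es = []"
| "traverse (f # fuel) [] es = []"
| "traverse (f # fuel) ((v, x) # work) es =
    (case expand v x es work [] of (work', es') \<Rightarrow> (v, x) # traverse fuel work' es')"

fun T_traverse :: "'b list \<Rightarrow> ('a \<times> int list) list \<Rightarrow> (nat \<times> 'a \<times> 'a) list \<Rightarrow> nat" where
  "T_traverse [] work es = 1"
| "T_traverse (f # fuel) [] es = 1"
| "T_traverse (f # fuel) ((v, x) # work) es =
    T_expand v x es work [] +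
    (case expand v x es work [] of (work', es') \<Rightarrow> T_traverse fuel work' es') + 1"

fun lookup :: "'a \<Rightarrow> ('a \<times> int list) list \<Rightarrow> int list" where
  "lookup v [] = []"
| "lookup v ((w, x) # ps) = (if v = w then x else lookup v ps)"

fun T_lookup :: "'a \<Rightarrow> ('a \<times> int list) list \<Rightarrow> nat" where
  "T_lookup v [] = 1"
| "T_lookup v ((w, x) # ps) = (if v = w then 0 else T_lookup v ps) + 1"

fun diff :: "int list \<Rightarrow> int list \<Rightarrow> int list" where
  "diff [] ys = []"
| "diff (x # xs) [] = []"
| "diff (x # xs) (y # ys) = (x - y) # diff xs ys"

fun T_diff :: "int list \<Rightarrow> int list \<Rightarrow> nat" where
  "T_diff [] ys = 1"
| "T_diff (x # xs) [] = 1"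
| "T_diff (x # xs) (y # ys) = T_diff xs ys + 1"

fun columns :: "('a \<times> int list) list \<Rightarrow> ('a \<times> 'a) list \<Rightarrow> int list list" where
  "columns ps [] = []"
| "columns ps ((h, t) # ks) = diff (lookup t ps) (lookup h ps) # columns ps ks"

fun T_columns :: "('a \<times> int list) list \<Rightarrow> ('a \<times> 'a) list \<Rightarrow> nat" where
  "T_columns ps [] = 1"
| "T_columns ps ((h, t) # ks) =
    T_lookup t ps + (T_lookup h ps + T_diff (lookup t ps) (lookup h ps)) + T_columns ps ks + 1"

fun tucker_columns :: "'a list \<Rightarrow> ('a \<times> 'a) list \<Rightarrow> ('a \<times> 'a) list \<Rightarrow> int list list" where
  "tucker_columns [] ts ks = []"
| "tucker_columns (v # vs) ts ks =
    columns (traverse (v # vs) [(v, zeros ts)] (number 0 ts)) ks"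

fun T_tucker_columns :: "'a list \<Rightarrow> ('a \<times> 'a) list \<Rightarrow> ('a \<times> 'a) list \<Rightarrow> nat" where
  "T_tucker_columns [] ts ks = 0"
| "T_tucker_columns (v # vs) ts ks =
    T_zeros ts + (T_number 0 ts + T_traverse (v # vs) [(v, zeros ts)] (number 0 ts)) +
    T_columns (traverse (v # vs) [(v, zeros ts)] (number 0 ts)) ks"

fun trues :: "'b list \<Rightarrow> bool list" where
  "trues [] = []"
| "trues (e # es) = True # trues es"

fun T_trues :: "'b list \<Rightarrow> nat" where
  "T_trues [] = 1"
| "T_trues (e # es) = T_trues es + 1"

fun and_zero :: "bool list \<Rightarrow> int list \<Rightarrow> bool list" where
  "and_zero [] xs = []"
| "and_zero (z # zs) [] = []"
| "and_zero (z # zs) (x # xs) = (z \<and> x = 0) # and_zero zs xs"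

fun T_and_zero :: "bool list \<Rightarrow> int list \<Rightarrow> nat" where
  "T_and_zero [] xs = 1"
| "T_and_zero (z # zs) [] = 1"
| "T_and_zero (z # zs) (x # xs) = T_and_zero zs xs + 1"

fun zero_flags :: "bool list \<Rightarrow> int list list \<Rightarrow> bool list" where
  "zero_flags zs [] = zs"
| "zero_flags zs (c # cs) = zero_flags (and_zero zs c) cs"

fun T_zero_flags :: "bool list \<Rightarrow> int list list \<Rightarrow> nat" where
  "T_zero_flags zs [] = 1"
| "T_zero_flags zs (c # cs) = T_and_zero zs c + T_zero_flags (and_zero zs c) cs + 1"

fun flagged :: "'b list \<Rightarrow> bool list \<Rightarrow> 'b list" where
  "flagged [] zs = []"
| "flagged (e # es) [] = []"
| "flagged (e # es) (z # zs) = (if z then e # flagged es zs else flagged es zs)"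

fun T_flagged :: "'b list \<Rightarrow> bool list \<Rightarrow> nat" where
  "T_flagged [] zs = 1"
| "T_flagged (e # es) [] = 1"
| "T_flagged (e # es) (z # zs) = T_flagged es zs + 1"

fun links :: "'a list list \<Rightarrow> ('a \<times> 'a) list \<Rightarrow> ('a list \<times> 'a list) list" where
  "links cs [] = []"
| "links cs ((u, v) # es) =
    (let c = cell_of u cs in
     if mem v c then links cs es else (c, cell_of v cs) # links cs es)"

fun T_links :: "'a list list \<Rightarrow> ('a \<times> 'a) list \<Rightarrow> nat" where
  "T_links cs [] = 1"
| "T_links cs ((u, v) # es) =
    T_cell_of u cs +
    (let c = cell_of u cs in
     T_mem v c + (if mem v c then T_links cs es else T_cell_of v cs + T_links cs es)) + 1"

fun contract :: "'a list \<Rightarrow> ('a \<times> 'a) list \<Rightarrow> ('a \<times> 'a) list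
    \<Rightarrow> 'a list list \<times> ('a list \<times> 'a list) list" where
  "contract vs es fs = (case sift (singletons vs) fs [] [] of (ts, ks, cs) \<Rightarrow> (cs, links cs es))"

fun T_contract :: "'a list \<Rightarrow> ('a \<times> 'a) list \<Rightarrow> ('a \<times> 'a) list \<Rightarrow> nat" where
  "T_contract vs es fs =
    T_singletons vs + T_sift (singletons vs) fs [] [] +
    (case sift (singletons vs) fs [] [] of (ts, ks, cs) \<Rightarrow> T_links cs es)"

fun choose_edges :: "'b list \<Rightarrow> int list list \<Rightarrow> nat \<Rightarrow> 'b list option" where
  "choose_edges ts M q =
    (let zs = flagged ts (zero_flags (trues ts) M) in
     if length zs < q then None else Some (take q zs))"

fun T_choose_edges :: "'b list \<Rightarrow> int list list \<Rightarrow> nat \<Rightarrow> nat" where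
  "T_choose_edges ts M q =
    T_trues ts + T_zero_flags (trues ts) M + T_flagged ts (zero_flags (trues ts) M) +
    (let zs = flagged ts (zero_flags (trues ts) M) in
     T_length zs + (if length zs < q then 0 else T_take q zs))"

fun reduce :: "'a list \<Rightarrow> ('a \<times> 'a) list \<Rightarrow> nat
    \<Rightarrow> ('a \<times> 'a) list \<times> ('a \<times> 'a) list \<times> int list list
      \<times> (('a \<times> 'a) list \<times> 'a list list \<times> ('a list \<times> 'a list) list) option" where
  "reduce vs es r =
    (case sift (singletons vs) es [] [] of (ts, ks, cs) \<Rightarrow>
       let M = tucker_columns vs ts ks in
       (ts, ks, M,
        case choose_edges ts M (length vs - r) of
          None \<Rightarrow> None
        | Some fs \<Rightarrow> Some (fs, contract vs es fs)))"

fun T_reduce :: "'a list \<Rightarrow> ('a \<times> 'a) list \<Rightarrow> nat \<Rightarrow> nat" where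
  "T_reduce vs es r =
    T_singletons vs + T_sift (singletons vs) es [] [] +
    (case sift (singletons vs) es [] [] of (ts, ks, cs) \<Rightarrow>
       T_tucker_columns vs ts ks +
       (let M = tucker_columns vs ts ks in
        T_length vs + T_choose_edges ts M (length vs - r) +
        (case choose_edges ts M (length vs - r) of
           None \<Rightarrow> 0
         | Some fs \<Rightarrow> T_contract vs es fs)))"

end

theory Submission
  imports Defs
begin

text \<open>
An edge is a bridge if its two ends are not connected by the remaining edges. The whole theorem rests
on two characterisations of bridges.

\<^bold>\<open>Cycle-invariance.\<close> Contracting \<open>F\<close> is cycle-invariant iff every edge of \<open>F\<close> is a bridge
(\<open>cycle_invariant_iff_bridges\<close>). Every simple cycle of the contraction lifts to a simple cycle of the
graph: cross from one cell to the next along an edge of the graph, and run inside each cell along a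
path of \<open>F\<close> (\<open>lift_path\<close>). The lifted cycle determines the original one, so the contraction never has more
cycles. The closing edge of a lifted cycle joins two different cells. If \<open>F\<close> contains an edge that is
not a bridge, then a cycle closed by that edge exists, it is not a lift, and the contraction has
strictly fewer cycles. If \<open>F\<close> consists of bridges, then a cycle never meets a cell twice
and two cells are joined by at most one edge, so that mapping vertices to their cells is an injection of
cycles (\<open>contract_bridges_inj\<close>); finiteness makes the two cycle counts equal.

\<^bold>\<open>The Tucker representation.\<close> For any spanning tree, the tree edges with zero rows are exactly
the bridges of the graph (\<open>zero_rows_eq_bridges\<close>). A tree edge on the tree path of a co-tree edge lies
on the cycle formed by that path and the co-tree edge. Conversely, if no such tree path uses a given tree edge,
then every connection in the graph that avoids the edge can be rerouted through the tree, still
avoiding it, which is impossible in a tree.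

Hence the sets that step 3 may choose are the solutions themselves, whichever spanning tree was taken
(\<open>step_3_iff_solution\<close>).

For the implementation, \<open>sift\<close> maintains a forest together with its components, and the labels that
\<open>traverse\<close> computes are potentials: along a tree edge they change by the unit vector of that edge.
So the difference of two labels is the signed path vector of the tree path
between them (\<open>tucker_columns_correct\<close>), and common parts of root paths need not be treated. The time
bound is a sum of products of two of the numbers of vertices, edges, tree edges and co-tree edges; it
is \<open>O(mn)\<close> because a forest has at most \<open>n\<close> edges and a connected graph on at least two
vertices has \<open>n \<le> 2 * m\<close>.
\<close>

section \<open>Connectivity, bridges and forests\<close>

definition conn :: "'a set set \<Rightarrow> ('a \<times> 'a) set" where
  "conn E = {(u, v). {u, v} \<in> E}\<^sup>*"

definition bridges :: "'a set set \<Rightarrow> 'a set set" where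
  "bridges E = {e \<in> E. \<forall>a\<in>e. \<forall>b\<in>e. a \<noteq> b \<longrightarrow> (a, b) \<notin> conn (E - {e})}"

lemma conn_refl [simp]: "(u, u) \<in> conn E"
  by (simp add: conn_def)

lemma conn_edge: "{u, v} \<in> E \<Longrightarrow> (u, v) \<in> conn E"
  by (auto simp: conn_def)

lemma conn_trans: "(u, v) \<in> conn E \<Longrightarrow> (v, w) \<in> conn E \<Longrightarrow> (u, w) \<in> conn E"
  unfolding conn_def by (rule rtrancl_trans)

lemma conn_sym: "(u, v) \<in> conn E \<Longrightarrow> (v, u) \<in> conn E"
proof -
  have "sym {(u, v). {u, v} \<in> E}"
    by (auto simp: sym_def insert_commute)
  then have "sym (conn E)"
    unfolding conn_def by (rule sym_rtrancl)
  then show "(u, v) \<in> conn E \<Longrightarrow> (v, u) \<in> conn E"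
    by (rule symD)
qed

lemma conn_induct [consumes 1, case_names base step]:
  assumes "(u, v) \<in> conn E" "P u"
    "\<And>y z. (u, y) \<in> conn E \<Longrightarrow> {y, z} \<in> E \<Longrightarrow> P y \<Longrightarrow> P z"
  shows "P v"
  using assms unfolding conn_def by (rule rtrancl_induct) auto

lemma conn_mono: "E \<subseteq> F \<Longrightarrow> (u, v) \<in> conn E \<Longrightarrow> (u, v) \<in> conn F"
  unfolding conn_def by (rule subsetD[OF rtrancl_mono]) auto

lemma conn_closed:
  assumes "(u, v) \<in> conn F" "\<And>x y. {x, y} \<in> F \<Longrightarrow> (x, y) \<in> conn E"
  shows "(u, v) \<in> conn E"
  using assms(1)
proof (induction rule: conn_induct)
  case (step y z)
  then show ?case
    using assms(2)[of y z] conn_trans[of u y E z] by blast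
qed simp

lemma conn_eqI:
  assumes "\<And>x y. {x, y} \<in> E \<Longrightarrow> (x, y) \<in> conn F" "\<And>x y. {x, y} \<in> F \<Longrightarrow> (x, y) \<in> conn E"
  shows "conn E = conn F"
proof (rule subset_antisym; rule subrelI)
  show "(x, y) \<in> conn E \<Longrightarrow> (x, y) \<in> conn F" for x y
    by (erule conn_closed) (rule assms(1))
  show "(x, y) \<in> conn F \<Longrightarrow> (x, y) \<in> conn E" for x y
    by (erule conn_closed) (rule assms(2))
qed

lemma conn_component: "(u, v) \<in> conn E \<Longrightarrow> conn E `` {u} = conn E `` {v}"
  using conn_trans[of u v E] conn_trans[of v u E] conn_sym[of u v E] by blast

lemma conn_invariant:
  assumes "(u, v) \<in> conn E" "u \<in> S" "\<And>x y. {x, y} \<in> E \<Longrightarrow> x \<in> S \<Longrightarrow> y \<in> S"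
  shows "v \<in> S"
  using assms(1) by (induction rule: conn_induct) (use assms(2,3) in auto)

text \<open>The new edge is needed at most once, in one of its two directions.\<close>

lemma conn_insert:
  "(x, y) \<in> conn (insert {u, v} E) \<longleftrightarrow>
    (x, y) \<in> conn E \<or> (x, u) \<in> conn E \<and> (v, y) \<in> conn E \<or> (x, v) \<in> conn E \<and> (u, y) \<in> conn E"
    (is "?L \<longleftrightarrow> ?R")
proof
  show "?R" if ?L
    using that
  proof (induction rule: conn_induct)
    case base
    show ?case by simp
  next
    case (step y z)
    from step(2) consider "{y, z} \<in> E" | "y = u" "z = v" | "y = v" "z = u"
      by (auto simp: doubleton_eq_iff)
    then show ?case
    proof cases
      case 1
      then have "(y, z) \<in> conn E" by (rule conn_edge)
      with step(3) show ?thesis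
        by (meson conn_trans)
    next
      case 2
      with step(3) show ?thesis
        by (meson conn_refl conn_sym conn_trans)
    next
      case 3
      with step(3) show ?thesis
        by (meson conn_refl conn_sym conn_trans)
    qed
  qed
next
  have "(a, b) \<in> conn E \<Longrightarrow> (a, b) \<in> conn (insert {u, v} E)" for a b
    by (rule conn_mono[of E]) auto
  moreover have "(u, v) \<in> conn (insert {u, v} E)" "(v, u) \<in> conn (insert {u, v} E)"
    by (rule conn_edge, simp add: insert_commute)+
  ultimately show "?R \<Longrightarrow> ?L"
    by (meson conn_trans)
qed

lemma bridges_subset: "bridges E \<subseteq> E"
  by (auto simp: bridges_def)

lemma bridgeD: "{a, b} \<in> bridges E \<Longrightarrow> a \<noteq> b \<Longrightarrow> (a, b) \<notin> conn (E - {{a, b}})"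
  by (auto simp: bridges_def)

lemma bridgeI: "{a, b} \<in> E \<Longrightarrow> (a, b) \<notin> conn (E - {{a, b}}) \<Longrightarrow> {a, b} \<in> bridges E"
  using conn_sym by (fastforce simp: bridges_def)

lemma simple_graph_edge:
  assumes "simple_graph V E" "{u, v} \<in> E"
  shows "u \<in> V" "v \<in> V" "u \<noteq> v"
proof -
  have "{u, v} \<subseteq> V" "card {u, v} = 2"
    using assms by (auto simp: simple_graph_def)
  then show "u \<in> V" "v \<in> V" "u \<noteq> v"
    by (auto simp: card_insert_if split: if_splits)
qed

lemma simple_graph_edge_obtain:
  assumes "simple_graph V E" "e \<in> E"
  obtains a b where "e = {a, b}" "a \<noteq> b" "a \<in> V" "b \<in> V"
  using assms by (auto simp: simple_graph_def card_2_iff)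

lemma simple_graph_subset: "simple_graph V E \<Longrightarrow> F \<subseteq> E \<Longrightarrow> simple_graph V F"
  by (auto simp: simple_graph_def)

lemma walk_conn:
  assumes "successively (\<lambda>u v. {u, v} \<in> E) p" "x \<in> set p" "y \<in> set p"
  shows "(x, y) \<in> conn E"
proof -
  have "(hd p, z) \<in> conn E" if "z \<in> set p" for z
    using assms(1) that
  proof (induction p arbitrary: z)
    case (Cons a p)
    show ?case
    proof (cases "z = a")
      case False
      with Cons.prems have "(hd p, z) \<in> conn E" "{a, hd p} \<in> E"
        using Cons.IH by (auto simp: successively_Cons)
      then show ?thesis
        using conn_edge conn_trans by (metis list.sel(1))
    qed simp
  qed simp
  with assms(2,3) show ?thesis
    by (meson conn_sym conn_trans)
qed

lemma conn_path:
  assumes "(u, v) \<in> conn E"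
  obtains p where "p \<noteq> []" "distinct p" "successively (\<lambda>u v. {u, v} \<in> E) p" "hd p = u" "last p = v"
proof -
  have "\<exists>p. p \<noteq> [] \<and> distinct p \<and> successively (\<lambda>u v. {u, v} \<in> E) p \<and> hd p = u \<and> last p = v"
    using assms unfolding conn_def
  proof (induction rule: converse_rtrancl_induct)
    case base
    show ?case by (intro exI[of _ "[v]"]) auto
  next
    case (step y z)
    then obtain p where p: "p \<noteq> []" "distinct p" "successively (\<lambda>u v. {u, v} \<in> E) p" "hd p = z" "last p = v"
      by blast
    show ?case
    proof (cases "y \<in> set p")
      case True
      then obtain xs ys where "p = xs @ y # ys"
        by (auto simp: in_set_conv_decomp)
      with p show ?thesis
        by (intro exI[of _ "y # ys"]) (auto simp: successively_append_iff)
    next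
      case False
      with p step(1) show ?thesis
        by (intro exI[of _ "y # p"]) (auto simp: successively_Cons)
    qed
  qed
  then show ?thesis using that by blast
qed

lemma linked_iff:
  assumes "simple_graph V E"
  shows "(u, v) \<in> linked V E \<longleftrightarrow> u \<in> V \<and> (u, v) \<in> conn E"
proof
  assume "(u, v) \<in> linked V E"
  then obtain p where p: "path V E p" "hd p = u" "last p = v"
    by (auto simp: linked_def)
  then have "u \<in> set p" "v \<in> set p"
    by (auto simp: path_def)
  with p show "u \<in> V \<and> (u, v) \<in> conn E"
    by (auto simp: path_def intro: walk_conn)
next
  assume asm: "u \<in> V \<and> (u, v) \<in> conn E"
  then obtain p where p: "p \<noteq> []" "distinct p" "successively (\<lambda>u v. {u, v} \<in> E) p" "hd p = u" "last p = v"
    by (elim conjE conn_path)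
  have "x \<in> V" if "x \<in> set p" for x
  proof -
    have "(u, x) \<in> conn E"
      using p that by (metis walk_conn hd_in_set)
    then show ?thesis
      using asm simple_graph_edge(2)[OF assms] by (metis conn_invariant)
  qed
  with p show "(u, v) \<in> linked V E"
    unfolding linked_def path_def by blast
qed

lemma connected_graph_iff:
  assumes "simple_graph V E"
  shows "connected_graph V E \<longleftrightarrow> V \<noteq> {} \<and> (\<forall>u\<in>V. \<forall>v\<in>V. (u, v) \<in> conn E)"
  using linked_iff[OF assms] by (auto simp: connected_graph_def)

text \<open>A path starts with an edge that it does not use again.\<close>

lemma conn_first_edge:
  assumes "(u, v) \<in> conn F" "u \<noteq> v"
  obtains w where "{u, w} \<in> F" "u \<noteq> w" "(w, v) \<in> conn (F - {{u, w}})"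
proof -
  obtain p where p: "p \<noteq> []" "distinct p" "successively (\<lambda>u v. {u, v} \<in> F) p" "hd p = u" "last p = v"
    using conn_path[OF assms(1)] .
  then obtain w q where q: "p = u # w # q"
    using assms(2) by (metis last.simps list.collapse)
  have "successively (\<lambda>u' v. {u', v} \<in> F - {{u, w}}) (w # q)"
    by (rule successively_mono[where P = "\<lambda>u v. {u, v} \<in> F"])
       (use p q in \<open>auto simp: doubleton_eq_iff\<close>)
  then have "(w, v) \<in> conn (F - {{u, w}})"
    by (rule walk_conn) (use p q in auto)
  with p q show ?thesis
    using that by auto
qed

lemma nonbridge_path:
  assumes "simple_graph V E" "{a, b} \<in> E" "{a, b} \<notin> bridges E"
  obtains p where "path V E p" "hd p = a" "last p = b" "length p \<ge> 3"
proof -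
  have "(a, b) \<in> conn (E - {{a, b}})"
    using assms bridgeI by metis
  moreover have "simple_graph V (E - {{a, b}})" "a \<in> V" "a \<noteq> b"
    using simple_graph_subset[OF assms(1)] simple_graph_edge[OF assms(1,2)] by blast+
  ultimately have "(a, b) \<in> linked V (E - {{a, b}})"
    by (simp add: linked_iff)
  then obtain p where p: "path V (E - {{a, b}}) p" "hd p = a" "last p = b"
    by (auto simp: linked_def)
  have "length p \<ge> 3"
  proof (rule ccontr)
    assume "\<not> ?thesis"
    with p \<open>a \<noteq> b\<close> have "p = [a, b]"
      by (cases p; cases "tl p"; cases "tl (tl p)") (auto simp: path_def)
    with p(1) show False by (simp add: path_def)
  qed
  moreover have "path V E p"
    using p(1) successively_mono[of "\<lambda>u v. {u, v} \<in> E - {{a, b}}" p "\<lambda>u v. {u, v} \<in> E"]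
    by (auto simp: path_def)
  ultimately show ?thesis using p that by blast
qed

text \<open>Going once around a cycle, no edge is used twice, so the rest of the cycle bypasses each of
  its edges.\<close>

lemma cycle_edge_nonbridge:
  assumes "path V E p" "length p \<ge> 3" "{last p, hd p} \<in> E" "p = xs @ a # b # ys"
  shows "{a, b} \<notin> bridges E"
proof
  assume "{a, b} \<in> bridges E"
  let ?E = "E - {{a, b}}"
  have dist: "distinct (xs @ a # b # ys)" and succ: "successively (\<lambda>u v. {u, v} \<in> E) (xs @ a # b # ys)"
    using assms(1,4) by (auto simp: path_def)
  have "successively (\<lambda>u v. {u, v} \<in> ?E) (b # ys)"
    by (rule successively_mono[where P = "\<lambda>u v. {u, v} \<in> E"])
       (use dist succ in \<open>auto simp: doubleton_eq_iff successively_append_iff\<close>)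
  then have 1: "(b, last p) \<in> conn ?E"
    by (rule walk_conn) (use assms(4) in auto)
  have "successively (\<lambda>u v. {u, v} \<in> E) (xs @ [a])"
    using succ by (auto simp: successively_append_iff)
  then have "successively (\<lambda>u v. {u, v} \<in> ?E) (xs @ [a])"
    by (rule successively_mono) (use dist in \<open>auto simp: doubleton_eq_iff\<close>)
  then have 2: "(hd p, a) \<in> conn ?E"
    by (rule walk_conn) (use assms(4) in \<open>cases xs; auto\<close>)+
  have "{last p, hd p} \<noteq> {a, b}"
    using assms(2,4) dist by (cases xs; cases ys rule: rev_cases) (auto simp: doubleton_eq_iff)
  then have "(last p, hd p) \<in> conn ?E"
    using assms(3) by (intro conn_edge) auto
  with 1 2 have "(b, a) \<in> conn ?E"
    by (meson conn_trans)
  moreover have "a \<noteq> b" using dist by auto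
  ultimately show False
    using bridgeD[OF \<open>{a, b} \<in> bridges E\<close>] conn_sym by metis
qed

text \<open>Unlike the absence of cycles, being a set of bridges is a statement about connectivity alone. This is
  the form in which forests are used throughout.\<close>

lemma acyclic_iff_bridges:
  assumes "simple_graph V T"
  shows "simple_cycles V T = {} \<longleftrightarrow> T \<subseteq> bridges T"
proof
  assume "simple_cycles V T = {}"
  show "T \<subseteq> bridges T"
  proof
    fix e assume "e \<in> T"
    then obtain a b where e: "e = {a, b}"
      using simple_graph_edge_obtain[OF assms] by metis
    show "e \<in> bridges T"
    proof (rule ccontr)
      assume "e \<notin> bridges T"
      then obtain p where "path V T p" "hd p = a" "last p = b" "length p \<ge> 3"
        using nonbridge_path[OF assms] e \<open>e \<in> T\<close> by metis
      then have "p @ [hd p] \<in> simple_cycles V T"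
        using e \<open>e \<in> T\<close> by (auto simp: simple_cycles_def insert_commute)
      with \<open>simple_cycles V T = {}\<close> show False by blast
    qed
  qed
next
  assume sub: "T \<subseteq> bridges T"
  show "simple_cycles V T = {}"
  proof (rule ccontr)
    assume "simple_cycles V T \<noteq> {}"
    then obtain p where p: "path V T p" "length p \<ge> 3" "{last p, hd p} \<in> T"
      by (auto simp: simple_cycles_def)
    then obtain a b ys where "p = [] @ a # b # ys"
      by (cases p; cases "tl p") auto
    with cycle_edge_nonbridge[OF p this] p(1) sub show False
      by (auto simp: path_def)
  qed
qed

text \<open>Where two paths with the same ends first part, going on along one of them and back along the other
  bypasses the first edge after the parting.\<close>

lemma forest_unique_path:
  assumes "T \<subseteq> bridges T" "path V T p" "path V T q" "hd p = hd q" "last p = last q"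
  shows "p = q"
  using assms(2-)
proof (induction p arbitrary: q)
  case Nil
  then show ?case by (simp add: path_def)
next
  case (Cons u p)
  from Cons.prems obtain q' where q: "q = u # q'"
    by (cases q) (auto simp: path_def)
  show ?case
  proof (cases "p = [] \<or> q' = []")
    case True
    with Cons.prems q show ?thesis
      by (cases p; cases q') (auto simp: path_def split: if_splits)
  next
    case False
    then obtain w p' w' q'' where pq: "p = w # p'" "q' = w' # q''"
      by (meson neq_Nil_conv)
    have "w = w'"
    proof (rule ccontr)
      assume "w \<noteq> w'"
      let ?T = "T - {{u, w}}"
      have "successively (\<lambda>u' v. {u', v} \<in> ?T) p"
        by (rule successively_mono[where P = "\<lambda>u v. {u, v} \<in> T"])
           (use Cons.prems pq in \<open>auto simp: path_def doubleton_eq_iff\<close>)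
      then have 1: "(w, last p) \<in> conn ?T"
        by (rule walk_conn) (use pq in auto)
      have "successively (\<lambda>u' v. {u', v} \<in> ?T) q'"
        by (rule successively_mono[where P = "\<lambda>u v. {u, v} \<in> T"])
           (use Cons.prems q pq in \<open>auto simp: path_def doubleton_eq_iff\<close>)
      then have 2: "(w', last q') \<in> conn ?T"
        by (rule walk_conn) (use pq in auto)
      have 3: "(u, w') \<in> conn ?T"
        by (rule conn_edge) (use \<open>w \<noteq> w'\<close> Cons.prems q pq in \<open>auto simp: path_def doubleton_eq_iff\<close>)
      have "last p = last q'"
        using Cons.prems q pq by auto
      with 1 2 3 have "(u, w) \<in> conn ?T"
        by (metis conn_sym conn_trans)
      moreover have "{u, w} \<in> T" "u \<noteq> w"
        using Cons.prems(1) pq by (auto simp: path_def)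
      ultimately show False
        using assms(1) bridgeD[of u w T] by auto
    qed
    with Cons.prems q pq have "p = q'"
      by (intro Cons.IH) (auto simp: path_def)
    with q show ?thesis by simp
  qed
qed

section \<open>Cycle-invariance means contracting bridges only\<close>

lemma edge_partition_eq:
  assumes "simple_graph V F"
  shows "edge_partition V F = (\<lambda>x. conn F `` {x}) ` V"
proof -
  have "linked V F `` {x} = conn F `` {x}" if "x \<in> V" for x
    using linked_iff[OF assms] that by auto
  then show ?thesis
    by (auto simp: edge_partition_def quotient_def)
qed

lemma component_eq_iff: "conn F `` {u} = conn F `` {v} \<longleftrightarrow> (u, v) \<in> conn F"
proof
  assume "conn F `` {u} = conn F `` {v}"
  moreover have "v \<in> conn F `` {v}" by simp
  ultimately show "(u, v) \<in> conn F" by blast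
qed (rule conn_component)

lemma contract_edgesD:
  assumes "{X, Y} \<in> contract_edges P E"
  shows "X \<noteq> Y" "\<exists>a\<in>X. \<exists>b\<in>Y. {a, b} \<in> E"
  using assms unfolding contract_edges_def doubleton_eq_iff mem_Collect_eq
  by (metis insert_commute)+

lemma contract_edges_iff:
  assumes "simple_graph V E" "F \<subseteq> E" "x \<in> V" "y \<in> V"
  shows "{conn F `` {x}, conn F `` {y}} \<in> contract_edges (edge_partition V F) E \<longleftrightarrow>
    (x, y) \<notin> conn F \<and> (\<exists>a b. (x, a) \<in> conn F \<and> (y, b) \<in> conn F \<and> {a, b} \<in> E)"
    (is "{?X, ?Y} \<in> _ \<longleftrightarrow> ?R")
proof
  assume "{?X, ?Y} \<in> contract_edges (edge_partition V F) E"
  from contract_edgesD[OF this] have ne: "?X \<noteq> ?Y" and ex: "\<exists>a\<in>?X. \<exists>b\<in>?Y. {a, b} \<in> E" .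
  have "(x, y) \<notin> conn F"
    using ne component_eq_iff[of F x y] by simp
  with ex show ?R
    by blast
next
  assume R: ?R
  have "?X \<in> edge_partition V F" "?Y \<in> edge_partition V F"
    using edge_partition_eq[OF simple_graph_subset[OF assms(1,2)]] assms(3,4) by auto
  moreover have "?X \<noteq> ?Y"
    using R component_eq_iff[of F x y] by blast
  moreover have "\<exists>a\<in>?X. \<exists>b\<in>?Y. {a, b} \<in> E"
    using R by blast
  ultimately show "{?X, ?Y} \<in> contract_edges (edge_partition V F) E"
    unfolding contract_edges_def by blast
qed

text \<open>A path inside the cell of \<open>u\<close> starts with a bridge. As the rest of the path does not use this bridge,
  its removal separates \<open>u\<close> from the other end of the path.\<close>

lemma bridge_separates:
  assumes "F \<subseteq> bridges E" "(u, v) \<in> conn F" "u \<noteq> v"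
  obtains f where "f \<in> F" "f \<subseteq> conn F `` {u}" "(u, v) \<notin> conn (E - {f})"
proof -
  obtain w where w: "{u, w} \<in> F" "u \<noteq> w" "(w, v) \<in> conn (F - {{u, w}})"
    using conn_first_edge[OF assms(2,3)] .
  then have "(u, w) \<notin> conn (E - {{u, w}})"
    using bridgeD[of u w E] assms(1) by auto
  moreover have "(w, v) \<in> conn (E - {{u, w}})"
    by (rule conn_mono[OF _ w(3)]) (use assms(1) bridges_subset in auto)
  ultimately have "(u, v) \<notin> conn (E - {{u, w}})"
    by (meson conn_sym conn_trans)
  moreover have "{u, w} \<subseteq> conn F `` {u}"
    using w(1) by (auto intro: conn_edge)
  ultimately show ?thesis
    using that w(1) by blast
qed

text \<open>Two different edges between the same two cells could be joined by paths inside the cells to form a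
  cycle that contains a bridge.\<close>

lemma unique_edge_between_components:
  assumes F: "F \<subseteq> bridges E"
    and E: "{a, b} \<in> E" "{a', b'} \<in> E"
    and same: "(a, a') \<in> conn F" "(b, b') \<in> conn F"
    and diff: "(a, b) \<notin> conn F"
  shows "a = a' \<and> b = b'"
proof -
  have "a = a'"
    if E: "{a, b} \<in> E" "{a', b'} \<in> E"
      and same: "(a, a') \<in> conn F" "(b, b') \<in> conn F" and diff: "(a, b) \<notin> conn F" for a a' b b'
  proof (rule ccontr)
    assume "a \<noteq> a'"
    then obtain f where f: "f \<in> F" "f \<subseteq> conn F `` {a}" "(a, a') \<notin> conn (E - {f})"
      using bridge_separates[OF F same(1)] by metis
    \<comment> \<open>The detour over the other cell avoids \<open>f\<close>, because \<open>f\<close> lies inside the cell of \<open>a\<close>.\<close>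
    have out: "y \<notin> f" if "(b, y) \<in> conn F" for y
    proof
      assume "y \<in> f"
      then have "(a, y) \<in> conn F" using f(2) by auto
      with that diff show False by (meson conn_sym conn_trans)
    qed
    have "(b, b') \<in> conn (E - {f})"
      using same(2)
    proof (induction rule: conn_induct)
      case (step y z)
      have "{y, z} \<noteq> f" using out[OF step(1)] by auto
      moreover have "{y, z} \<in> E" using step(2) F bridges_subset by auto
      ultimately show ?case
        using step(3) conn_edge[of y z "E - {f}"] by (auto intro: conn_trans)
    qed simp
    moreover have "(a, b) \<in> conn (E - {f})"
      by (rule conn_edge) (use E(1) out[of b] in auto)
    moreover have "(b', a') \<in> conn (E - {f})"
      by (rule conn_edge) (use E(2) out[OF same(2)] in \<open>auto simp: insert_commute\<close>)
    ultimately show False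
      using f(3) by (meson conn_trans)
  qed
  note main = this
  have "(b, a) \<notin> conn F" "{b, a} \<in> E" "{b', a'} \<in> E"
    using diff E conn_sym[of b a F] by (auto simp: insert_commute)
  then show ?thesis
    using main[OF E same diff] main[of b a b' a'] same by blast
qed

lemma finite_simple_cycles:
  assumes "finite V"
  shows "finite (simple_cycles V E)"
proof (rule finite_subset)
  show "simple_cycles V E \<subseteq> (\<lambda>p. p @ [hd p]) ` {p. set p \<subseteq> V \<and> length p \<le> card V}"
    using assms by (auto simp: simple_cycles_def path_def distinct_card[symmetric] intro!: card_mono)
  show "finite ((\<lambda>p. p @ [hd p]) ` {p. set p \<subseteq> V \<and> length p \<le> card V})"
    using assms by (intro finite_imageI finite_lists_length_le)
qed

text \<open>A cycle consists of edges that are not bridges, so any two of its vertices stay connected after the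
  removal of a bridge. Hence no two of them lie in the same cell, and the image is again a
  simple cycle. It determines the cycle, since there is only one edge between two cells.\<close>

lemma contract_bridges_inj:
  assumes G: "simple_graph V E" and F: "F \<subseteq> bridges E"
  defines "\<phi> \<equiv> map (\<lambda>x. conn F `` {x})"
  shows "inj_on \<phi> (simple_cycles V E)"
    and "\<phi> ` simple_cycles V E \<subseteq> simple_cycles (edge_partition V F) (contract_edges (edge_partition V F) E)"
proof -
  have FE: "F \<subseteq> E" using F bridges_subset by blast
  have sep: "x = y"
    if p: "path V E p" "length p \<ge> 3" "{last p, hd p} \<in> E" and xy: "x \<in> set p" "y \<in> set p" "(x, y) \<in> conn F"
    for p x y
  proof (rule ccontr)
    assume "x \<noteq> y"
    then obtain f where f: "f \<in> F" "(x, y) \<notin> conn (E - {f})"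
      using bridge_separates[OF F xy(3)] by metis
    have "successively (\<lambda>u v. {u, v} \<in> E - {f}) p"
      unfolding successively_conv_nth
    proof (intro allI impI)
      fix i assume i: "Suc i < length p"
      then have "p = take i p @ p ! i # p ! Suc i # drop (Suc (Suc i)) p"
        by (simp add: Cons_nth_drop_Suc)
      then have "{p ! i, p ! Suc i} \<notin> bridges E"
        using cycle_edge_nonbridge[OF p] by blast
      moreover have "{p ! i, p ! Suc i} \<in> E"
        using p(1) i by (auto simp: path_def successively_conv_nth)
      ultimately show "{p ! i, p ! Suc i} \<in> E - {f}"
        using f(1) F by auto
    qed
    then show False
      using walk_conn xy(1,2) f(2) by metis
  qed
  have cyc: "{c ! i, c ! Suc i} \<in> E \<and> (c ! i, c ! Suc i) \<notin> conn F \<and> c ! i \<in> V \<and> c ! Suc i \<in> V"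
    if c: "c \<in> simple_cycles V E" "Suc i < length c" for c i
  proof -
    obtain p where p: "path V E p" "length p \<ge> 3" "{last p, hd p} \<in> E" "c = p @ [hd p]"
      using c(1) by (auto simp: simple_cycles_def)
    have succ: "successively (\<lambda>u v. {u, v} \<in> E) c"
      using p by (auto simp: path_def successively_append_iff)
    have edge: "{c ! i, c ! Suc i} \<in> E"
      using successively_nth[OF succ c(2)] .
    have "set c \<subseteq> set p"
      using p by (cases p) auto
    then have "c ! i \<in> set p" "c ! Suc i \<in> set p"
      using c(2) by (meson Suc_lessD nth_mem subsetD)+
    then show ?thesis
      using edge simple_graph_edge[OF G edge] sep[OF p(1-3)] by blast
  qed
  show "inj_on \<phi> (simple_cycles V E)"
  proof (rule inj_onI)
    fix c d assume cd: "c \<in> simple_cycles V E" "d \<in> simple_cycles V E" "\<phi> c = \<phi> d"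
    have len: "length c = length d"
      using cd(3) unfolding \<phi>_def by (metis length_map)
    have conn: "(c ! i, d ! i) \<in> conn F" if "i < length c" for i
    proof -
      have "\<phi> c ! i = \<phi> d ! i" using cd(3) by simp
      then show ?thesis using that len unfolding \<phi>_def by (simp add: component_eq_iff)
    qed
    have eq: "c ! i = d ! i \<and> c ! Suc i = d ! Suc i" if i: "Suc i < length c" for i
      by (rule unique_edge_between_components[OF F])
         (use cyc[OF cd(1) i] cyc[OF cd(2)] conn i len in auto)
    have "length c \<ge> 4"
      using cd(1) by (auto simp: simple_cycles_def)
    then have "c ! i = d ! i" if "i < length c" for i
      using eq[of i] eq[of "i - 1"] that by (cases "Suc i < length c") auto
    then show "c = d"
      using len by (intro nth_equalityI) auto
  qed
  show "\<phi> ` simple_cycles V E \<subseteq> simple_cycles (edge_partition V F) (contract_edges (edge_partition V F) E)"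
  proof (intro image_subsetI)
    fix c assume c: "c \<in> simple_cycles V E"
    then obtain p where p: "path V E p" "length p \<ge> 3" "{last p, hd p} \<in> E" "c = p @ [hd p]"
      by (auto simp: simple_cycles_def)
    let ?P = "edge_partition V F"
    have ne: "p \<noteq> []" and pV: "set p \<subseteq> V" using p(1) by (auto simp: path_def)
    have edge: "{conn F `` {c ! i}, conn F `` {c ! Suc i}} \<in> contract_edges ?P E"
      if "Suc i < length c" for i
      using cyc[OF c that] contract_edges_iff[OF G FE, of "c ! i" "c ! Suc i"] conn_refl by metis
    then have succ: "successively (\<lambda>A B. {A, B} \<in> contract_edges ?P E) (\<phi> c)"
      unfolding successively_conv_nth \<phi>_def by auto
    have eq: "\<phi> c = \<phi> p @ [hd (\<phi> p)]"
      using ne by (simp add: \<phi>_def p(4) hd_map)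
    have "\<phi> p \<noteq> []" "length (\<phi> p) \<ge> 3"
      using ne p(2) by (auto simp: \<phi>_def)
    moreover have "distinct (\<phi> p)"
      unfolding \<phi>_def distinct_map using p(1)
      by (auto simp: path_def inj_on_def component_eq_iff dest: sep[OF p(1-3)])
    moreover have "set (\<phi> p) \<subseteq> ?P"
      using pV edge_partition_eq[OF simple_graph_subset[OF G FE]] by (auto simp: \<phi>_def)
    moreover have "successively (\<lambda>A B. {A, B} \<in> contract_edges ?P E) (\<phi> p)"
        "{last (\<phi> p), hd (\<phi> p)} \<in> contract_edges ?P E"
      using succ \<open>\<phi> p \<noteq> []\<close> unfolding eq by (auto simp: successively_append_iff)
    ultimately show "\<phi> c \<in> simple_cycles ?P (contract_edges ?P E)"
      unfolding simple_cycles_def path_def eq by blast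
  qed
qed

lemma remdups_constant_prefix:
  "xs \<noteq> [] \<Longrightarrow> set xs \<subseteq> {x} \<Longrightarrow> x \<notin> set ys \<Longrightarrow> remdups (xs @ ys) = x # remdups ys"
proof (induction xs)
  case (Cons a xs)
  then show ?case by (cases xs) auto
qed simp

text \<open>Both ends can be prescribed within the first and the last cell. This freedom is what the induction
  needs in order to continue from the entry point of the next cell, and what later allows the lifted path to be closed
  to a cycle. Since the cells are met one after the other, removing duplicates recovers the path of
  cells.\<close>

lemma lift_path:
  assumes G: "simple_graph V E" and FE: "F \<subseteq> E"
  assumes "path (edge_partition V F) (contract_edges (edge_partition V F) E) Cs"
    and "b \<in> hd Cs" "z \<in> last Cs"
  shows "\<exists>p. path V E p \<and> hd p = b \<and> last p = z \<and> remdups (map (\<lambda>x. conn F `` {x}) p) = Cs"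
  using assms(3-)
proof (induction Cs arbitrary: b)
  case Nil
  then show ?case by (simp add: path_def)
next
  case (Cons C Cs)
  let ?P = "edge_partition V F" and ?c = "\<lambda>x. conn F `` {x}"
  have GF: "simple_graph V F" using simple_graph_subset[OF G FE] .
  have P: "?P = ?c ` V" using edge_partition_eq[OF GF] .
  have cell: "x \<in> V \<and> ?c x = D" if "D \<in> ?P" "x \<in> D" for x D
  proof -
    from that obtain y where y: "y \<in> V" "D = ?c y" "(y, x) \<in> conn F"
      by (auto simp: P)
    moreover have "x \<in> V"
      using y simple_graph_edge(2)[OF GF] by (metis conn_invariant)
    ultimately show ?thesis using conn_component[of y x F] by auto
  qed
  have inside: "\<exists>p. path V E p \<and> hd p = b \<and> last p = a \<and> p \<noteq> [] \<and> set (map ?c p) \<subseteq> {C}"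
    if "a \<in> C" for a
  proof -
    have CP: "C \<in> ?P" and bC: "b \<in> C" using Cons.prems by (auto simp: path_def)
    have "?c b = ?c a" "b \<in> V" using cell[OF CP] bC that by auto
    then have "(b, a) \<in> linked V F"
      by (simp add: linked_iff[OF GF] component_eq_iff)
    then obtain p where p: "path V F p" "hd p = b" "last p = a"
      by (auto simp: linked_def)
    have "successively (\<lambda>u v. {u, v} \<in> E) p"
      using p(1) FE successively_mono[of "\<lambda>u v. {u, v} \<in> F" p "\<lambda>u v. {u, v} \<in> E"]
      by (auto simp: path_def)
    moreover have "?c x = C" if "x \<in> set p" for x
    proof -
      have "(b, x) \<in> conn F"
        using p that walk_conn[of F p b x] by (auto simp: path_def)
      then have "?c x = ?c b" by (metis conn_component)
      then show ?thesis using cell[OF CP bC] by simp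
    qed
    ultimately show ?thesis
      using p by (intro exI[of _ p]) (auto simp: path_def)
  qed
  show ?case
  proof (cases "Cs = []")
    case True
    then have "z \<in> C" using Cons.prems by simp
    from inside[OF this] obtain p where
      p: "path V E p" "hd p = b" "last p = z" "p \<noteq> []" "set (map ?c p) \<subseteq> {C}"
      by blast
    then have "remdups (map ?c p) = [C]"
      using remdups_constant_prefix[of "map ?c p" C "[]"] by simp
    with p True show ?thesis by blast
  next
    case False
    then have edge: "{C, hd Cs} \<in> contract_edges ?P E"
      using Cons.prems by (auto simp: path_def successively_Cons)
    have rest: "path ?P (contract_edges ?P E) Cs" and CCs: "C \<notin> set Cs" "C \<in> ?P"
      using Cons.prems False by (auto simp: path_def successively_Cons)
    obtain x y where xy: "x \<in> V" "y \<in> V" "C = ?c x" "hd Cs = ?c y"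
    proof -
      have "hd Cs \<in> ?P" using rest False by (auto simp: path_def)
      with CCs(2) show ?thesis using that by (auto simp only: P image_iff)
    qed
    with edge obtain a d where ad: "a \<in> C" "d \<in> hd Cs" "{a, d} \<in> E"
      using contract_edges_iff[OF G FE xy(1,2)] by auto
    obtain q where q: "path V E q" "hd q = d" "last q = z" "remdups (map ?c q) = Cs"
      using Cons.IH[OF rest ad(2)] Cons.prems False by auto
    obtain p where p: "path V E p" "hd p = b" "last p = a" "p \<noteq> []" "set (map ?c p) \<subseteq> {C}"
      using inside[OF ad(1)] by blast
    have cells_q: "set (map ?c q) = set Cs" using q(4) by (metis set_remdups)
    have "set p \<inter> set q = {}"
    proof -
      have "?c x \<noteq> ?c y" if "x \<in> set p" "y \<in> set q" for x y
      proof -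
        have "?c x = C" using p(5) that by auto
        moreover have "?c y \<in> set Cs" using cells_q that by auto
        ultimately show ?thesis using CCs(1) by auto
      qed
      then show ?thesis by blast
    qed
    then have "path V E (p @ q)"
      using p(1,3) q(1,2) ad(3) by (auto simp: path_def successively_append_iff)
    moreover have "remdups (map ?c (p @ q)) = C # Cs"
      using remdups_constant_prefix[of "map ?c p" C "map ?c q"] p(4,5) cells_q CCs(1) q(4) by simp
    moreover have "hd (p @ q) = b" "last (p @ q) = z"
      using p q by (auto simp: path_def)
    ultimately show ?thesis by blast
  qed
qed

text \<open>\<open>X\<close> is the set of cycles whose closing edge joins two cells; it contains all lifts. As cycles are
  sequences with a starting point, an edge that lies on some cycle is also the closing edge of a cycle, so \<open>X\<close>
  misses a cycle as soon as an edge within a cell is not a bridge.\<close>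

lemma cycle_invariant_iff_bridges:
  assumes G: "simple_graph V E" and FE: "F \<subseteq> E"
  shows "cycle_invariant V E (edge_partition V F) \<longleftrightarrow> F \<subseteq> bridges E"
proof -
  let ?P = "edge_partition V F" and ?c = "\<lambda>x. conn F `` {x}"
  let ?C = "simple_cycles V E" and ?D = "simple_cycles ?P (contract_edges ?P E)"
  define X where "X = {p @ [hd p] | p. path V E p \<and> length p \<ge> 3 \<and> {last p, hd p} \<in> E \<and> ?c (last p) \<noteq> ?c (hd p)}"
  define \<psi> where "\<psi> = (\<lambda>p. remdups (map ?c (butlast p)) @ [?c (hd p)])"
  have GF: "simple_graph V F" using simple_graph_subset[OF G FE] .
  have P: "?P = ?c ` V" using edge_partition_eq[OF GF] .
  have finV: "finite V" using G by (simp add: simple_graph_def)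
  have finC: "finite ?C" using finite_simple_cycles[OF finV] .
  have finD: "finite ?D" by (rule finite_simple_cycles) (simp add: P finV)
  have XC: "X \<subseteq> ?C" by (auto simp: X_def simple_cycles_def)
  have D: "?D \<subseteq> \<psi> ` X"
  proof
    fix c assume "c \<in> ?D"
    then obtain Cs where Cs: "path ?P (contract_edges ?P E) Cs" "length Cs \<ge> 3"
        "{last Cs, hd Cs} \<in> contract_edges ?P E" "c = Cs @ [hd Cs]"
      by (auto simp: simple_cycles_def)
    have "Cs \<noteq> []" using Cs(2) by auto
    then have "hd Cs \<in> ?P" "last Cs \<in> ?P"
      using Cs(1) by (auto simp: path_def)
    then obtain x y where xy: "hd Cs = ?c x" "last Cs = ?c y"
      unfolding P by blast
    obtain z b where zb: "z \<in> last Cs" "b \<in> hd Cs" "{z, b} \<in> E"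
      using contract_edgesD(2)[OF Cs(3)] by blast
    obtain p where p: "path V E p" "hd p = b" "last p = z" "remdups (map ?c p) = Cs"
      using lift_path[OF G FE Cs(1) zb(2,1)] by blast
    have "length Cs \<le> length p"
      using length_remdups_leq[of "map ?c p"] p(4) by simp
    moreover have b: "?c b = hd Cs" and z: "?c z = last Cs"
      using zb(1,2) unfolding xy by (auto intro!: conn_component[symmetric])
    moreover have "hd Cs \<noteq> last Cs"
      using contract_edgesD(1)[OF Cs(3)] by simp
    ultimately have "p @ [hd p] \<in> X"
      using p Cs(2) zb(3) unfolding X_def by auto
    moreover have "\<psi> (p @ [hd p]) = c"
      using p b Cs(4) by (cases p) (auto simp: \<psi>_def path_def)
    ultimately show "c \<in> \<psi> ` X" by blast
  qed
  have finX: "finite X" using finite_subset[OF XC finC] .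
  have le: "card ?D \<le> card X"
    using card_mono[OF finite_imageI[OF finX] D] card_image_le[OF finX, of \<psi>] by linarith
  show ?thesis
  proof
    assume "cycle_invariant V E ?P"
    then have "card ?C = card ?D"
      by (auto simp: cycle_invariant_def dest: bij_betw_same_card)
    then have "X = ?C"
      using le card_mono[OF finC XC] by (intro card_subset_eq[OF finC XC]) linarith
    show "F \<subseteq> bridges E"
    proof (rule ccontr)
      assume "\<not> ?thesis"
      then obtain e where e: "e \<in> F" "e \<notin> bridges E" by blast
      then obtain a b where ab: "e = {a, b}"
        using simple_graph_edge_obtain[OF GF] by metis
      then obtain p where p: "path V E p" "hd p = a" "last p = b" "length p \<ge> 3"
        using nonbridge_path[OF G, of a b] e FE by blast
      have "{last p, hd p} \<in> E" using p e FE ab by (auto simp: insert_commute)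
      with p have "p @ [hd p] \<in> X"
        unfolding \<open>X = ?C\<close> simple_cycles_def by blast
      then obtain q where "p @ [hd p] = q @ [hd q]" "?c (last q) \<noteq> ?c (hd q)"
        unfolding X_def by blast
      with p have "?c b \<noteq> ?c a" by simp
      moreover have "(b, a) \<in> conn F"
        using e ab by (intro conn_edge) (simp add: insert_commute)
      ultimately show False using conn_component by metis
    qed
  next
    assume F: "F \<subseteq> bridges E"
    have "card ?C \<le> card ?D"
      using card_inj_on_le[OF contract_bridges_inj[OF G F] finD] .
    then have "card ?C = card ?D"
      using le card_mono[OF finC XC] by linarith
    then show "cycle_invariant V E ?P"
      unfolding cycle_invariant_def using finite_same_card_bij[OF finC finD] by blast
  qed
qed

lemma spanning_treeD:
  assumes "simple_graph V E" "spanning_tree V E T"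
  shows "T \<subseteq> E" "simple_graph V T" "T \<subseteq> bridges T" "connected_graph V T"
  using assms simple_graph_subset[of V E T] acyclic_iff_bridges[of V T]
  by (simp_all add: spanning_tree_def)

lemma spanning_tree_path:
  assumes G: "simple_graph V E" and T: "spanning_tree V E T" and uv: "u \<in> V" "v \<in> V"
  shows "path V T (tree_path V T u v)" "hd (tree_path V T u v) = u" "last (tree_path V T u v) = v"
proof -
  note TT = spanning_treeD(3)[OF G T]
  have "(u, v) \<in> linked V T"
    using spanning_treeD(4)[OF G T] uv by (auto simp: connected_graph_def)
  then have "\<exists>!p. path V T p \<and> hd p = u \<and> last p = v"
    using forest_unique_path[OF TT] by (fastforce simp: linked_def)
  from theI'[OF this]
  show "path V T (tree_path V T u v)" "hd (tree_path V T u v) = u" "last (tree_path V T u v) = v"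
    unfolding tree_path_def by auto
qed

lemma bridges_subset_spanning_tree:
  assumes G: "simple_graph V E" and T: "spanning_tree V E T"
  shows "bridges E \<subseteq> T"
proof
  fix e assume e: "e \<in> bridges E"
  then have "e \<in> E" using bridges_subset by blast
  then obtain a b where ab: "e = {a, b}" "a \<noteq> b" "a \<in> V" "b \<in> V"
    using simple_graph_edge_obtain[OF G] by metis
  show "e \<in> T"
  proof (rule ccontr)
    assume "e \<notin> T"
    then have "T \<subseteq> E - {e}" using T by (auto simp: spanning_tree_def)
    moreover have "(a, b) \<in> conn T"
      using connected_graph_iff[OF spanning_treeD(2)[OF G T]] spanning_treeD(4)[OF G T] ab by simp
    ultimately have "(a, b) \<in> conn (E - {e})"
      by (rule conn_mono)
    then show False using bridgeD[of a b E] e ab by simp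
  qed
qed

lemma successively_zip:
  "successively P p \<longleftrightarrow> (\<forall>(u, v)\<in>set (zip p (tl p)). P u v)"
  by (induction P p rule: successively.induct) auto

text \<open>If a tree edge is on the tree path of a co-tree edge, then the two lie on a common cycle. If it is on
  none of these paths, then replacing each co-tree edge by its tree path turns any bypass of the tree
  edge into a bypass inside the tree. The set \<open>K\<close> holds one orientation of each co-tree edge, which spares a
  comparison of the tree paths in the two directions.\<close>

lemma tree_edge_bridge_iff:
  assumes G: "simple_graph V E" and T: "spanning_tree V E T" and ab: "{a, b} \<in> T"
    and K: "und ` K = E - T"
  shows "{a, b} \<in> bridges E \<longleftrightarrow>
    (\<forall>(u, v)\<in>K. (a, b) \<notin> set (zip (tree_path V T u v) (tl (tree_path V T u v))) \<and>
      (b, a) \<notin> set (zip (tree_path V T u v) (tl (tree_path V T u v))))"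
    (is "_ \<longleftrightarrow> ?R")
proof -
  let ?E = "E - {{a, b}}"
  have KE: "{u, v} \<in> E - T" if "(u, v) \<in> K" for u v
    using imageI[OF that, of und] K by (simp add: und_def)
  note TE = spanning_treeD(1)[OF G T] and TT = spanning_treeD(3)[OF G T]
  have ab': "a \<noteq> b" using simple_graph_edge(3)[OF G] ab TE by blast
  have ?R if br: "{a, b} \<in> bridges E"
  proof -
    have avoid: "(x, y) \<notin> set (zip p (tl p))"
      if xy: "{x, y} = {a, b}" and uv: "{u, v} \<in> E - T" and p: "p = tree_path V T u v" for x y u v p
    proof
      assume "(x, y) \<in> set (zip p (tl p))"
      then obtain i where i: "Suc i < length p" "x = p ! i" "y = p ! Suc i"
        by (auto simp: set_zip nth_tl less_diff_conv)
      then have dec: "p = take i p @ x # y # drop (Suc (Suc i)) p"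
        by (simp add: Cons_nth_drop_Suc)
      have uvV: "u \<in> V" "v \<in> V" using simple_graph_edge[OF G, of u v] uv by auto
      note pp = spanning_tree_path[OF G T uvV, folded p]
      have p': "path V E p"
        using pp(1) TE successively_mono[of "\<lambda>u v. {u, v} \<in> T" p "\<lambda>u v. {u, v} \<in> E"]
        by (auto simp: path_def)
      \<comment> \<open>A path with only two vertices would make the tree edge equal to the co-tree edge.\<close>
      have "length p \<noteq> 2"
      proof
        assume "length p = 2"
        then have "p = [x, y]" using i by (cases p; cases "tl p") auto
        then have "{u, v} = {x, y}" using pp by auto
        then show False using uv ab xy by auto
      qed
      then have "length p \<ge> 3" using i(1) by linarith
      moreover have "{last p, hd p} \<in> E" using pp uv by (auto simp: insert_commute)
      ultimately show False
        using cycle_edge_nonbridge[OF p' _ _ dec] br xy by simp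
    qed
    show ?R
      using avoid[OF refl KE refl] avoid[OF insert_commute KE refl] by blast
  qed
  moreover have "{a, b} \<in> bridges E" if R: ?R
    proof (rule bridgeI)
      show "{a, b} \<in> E" using ab TE by blast
      have via_tree: "(x, y) \<in> conn (T - {{a, b}})" if xy: "(x, y) \<in> K" for x y
      proof -
        let ?p = "tree_path V T x y"
        have "{x, y} \<in> E" using KE[OF xy] by simp
        then have V: "x \<in> V" "y \<in> V" using simple_graph_edge[OF G, of x y] by auto
        note pp = spanning_tree_path[OF G T V]
        have "{u, v} \<in> T - {{a, b}}" if "(u, v) \<in> set (zip ?p (tl ?p))" for u v
        proof -
          have "{u, v} \<in> T"
            using pp(1) that by (auto simp: path_def successively_zip)
          moreover have "{u, v} \<noteq> {a, b}"
            using R xy that by (auto simp: doubleton_eq_iff)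
          ultimately show ?thesis by blast
        qed
        then have "successively (\<lambda>u v. {u, v} \<in> T - {{a, b}}) ?p"
          unfolding successively_zip by blast
        moreover have "x \<in> set ?p" "y \<in> set ?p"
          using pp hd_in_set[of ?p] last_in_set[of ?p] by (auto simp: path_def)
        ultimately show ?thesis by (rule walk_conn)
      qed
      have "(x, y) \<in> conn (T - {{a, b}})" if xy: "{x, y} \<in> ?E" for x y
      proof (cases "{x, y} \<in> T")
        case True
        then show ?thesis using xy by (intro conn_edge) auto
      next
        case False
        then have "{x, y} \<in> und ` K" using K xy by auto
        then have "(x, y) \<in> K \<or> (y, x) \<in> K"
          by (auto simp: und_def doubleton_eq_iff)
        then show ?thesis using via_tree conn_sym by metis
      qed
      then have "(a, b) \<in> conn ?E \<Longrightarrow> (a, b) \<in> conn (T - {{a, b}})"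
        using conn_closed[of a b ?E "T - {{a, b}}"] by simp
      moreover have "(a, b) \<notin> conn (T - {{a, b}})"
        using bridgeD[of a b T] TT ab ab' by auto
      ultimately show "(a, b) \<notin> conn ?E" by blast
    qed
  ultimately show ?thesis by blast
qed

text \<open>The right-hand side does not mention the spanning tree. This is why a solution, if there is one, can
  be found with any spanning tree.\<close>

lemma zero_rows_eq_bridges:
  assumes G: "simple_graph V E" and S: "steps_1_2 V E ts ks M"
  shows "{und (ts ! k) | k. k < dim_row M \<and> row M k = 0\<^sub>v (dim_col M)} = bridges E"
proof -
  obtain T where T: "spanning_tree V E T" "oriented_list T ts" "oriented_list (E - T) ks" "M = tucker V ts ks"
    using S by (auto simp: steps_1_2_def)
  have uT: "und ` set ts = T" and uK: "und ` set ks = E - T"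
    using T by (auto simp: oriented_list_def)
  have TE: "T \<subseteq> E" using T(1) by (auto simp: spanning_tree_def)
  have GT: "simple_graph V T" using simple_graph_subset[OF G TE] .
  have dim: "dim_row M = length ts" "dim_col M = length ks"
    by (auto simp: T(4) tucker_def)
  have key: "row M k = 0\<^sub>v (dim_col M) \<longleftrightarrow> und (ts ! k) \<in> bridges E" if k: "k < length ts" for k
  proof -
    obtain a b where ab: "ts ! k = (a, b)" by force
    then have abT: "{a, b} \<in> T" using uT k by (force simp: und_def dest: nth_mem)
    let ?on = "\<lambda>u v. (a, b) \<in> set (zip (tree_path V T u v) (tl (tree_path V T u v))) \<or>
      (b, a) \<in> set (zip (tree_path V T u v) (tl (tree_path V T u v)))"
    have "row M k = 0\<^sub>v (dim_col M) \<longleftrightarrow> (\<forall>j<length ks. M $$ (k, j) = 0)"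
      using k dim by (auto simp: vec_eq_iff)
    also have "\<dots> \<longleftrightarrow> (\<forall>j<length ks. \<not> ?on (fst (ks ! j)) (snd (ks ! j)))"
      using k by (auto simp: T(4) tucker_def uT path_sign_def ab)
    also have "\<dots> \<longleftrightarrow> (\<forall>(u, v)\<in>set ks. \<not> ?on u v)"
      unfolding case_prod_unfold by (metis in_set_conv_nth)
    also have "\<dots> \<longleftrightarrow> {a, b} \<in> bridges E"
      using tree_edge_bridge_iff[OF G T(1) abT uK] by simp
    finally show ?thesis by (simp add: ab und_def)
  qed
  have "{und (ts ! k) | k. k < dim_row M \<and> row M k = 0\<^sub>v (dim_col M)} =
      {und (ts ! k) | k. k < length ts \<and> und (ts ! k) \<in> bridges E}"
    using key dim by auto
  also have "\<dots> = T \<inter> bridges E"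
    unfolding uT[symmetric] by (force simp: set_conv_nth)
  also have "\<dots> = bridges E"
    using bridges_subset_spanning_tree[OF G T(1)] by blast
  finally show ?thesis .
qed

lemma step_3_iff_solution:
  assumes G: "simple_graph V E" and S: "steps_1_2 V E ts ks M"
  shows "step_3 (card V - r) ts M F \<longleftrightarrow> solution V E r F"
proof -
  have "F \<subseteq> bridges E \<longleftrightarrow> F \<subseteq> E \<and> cycle_invariant V E (edge_partition V F)"
    using cycle_invariant_iff_bridges[OF G] bridges_subset[of E] by blast
  then show ?thesis
    unfolding step_3_def solution_def zero_rows_eq_bridges[OF G S] by blast
qed

section \<open>Growing the spanning forest\<close>

definition component_list :: "'a set \<Rightarrow> 'a set set \<Rightarrow> 'a list list \<Rightarrow> bool" where
  "component_list V F cs \<longleftrightarrow> distinct (concat cs) \<and> [] \<notin> set cs \<and> set (concat cs) = V \<and>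
    (\<forall>c\<in>set cs. \<forall>x\<in>set c. set c = conn F `` {x})"

lemma mem_iff [simp]: "mem x ys \<longleftrightarrow> x \<in> set ys"
  by (induction ys) auto

lemma cell_of_mem:
  "x \<in> set (concat cs) \<Longrightarrow> cell_of x cs \<in> set cs \<and> x \<in> set (cell_of x cs)"
  by (induction cs) auto

lemma mset_drop_cell:
  "x \<in> set (concat cs) \<Longrightarrow> mset cs = add_mset (cell_of x cs) (mset (drop_cell x cs))"
  by (induction cs) auto

lemma cell_of_drop_cell:
  "u \<notin> set (cell_of v cs) \<Longrightarrow> cell_of u (drop_cell v cs) = cell_of u cs"
  by (induction cs) auto

lemma mset_concat_cong:
  assumes "mset cs = mset ds"
  shows "mset (concat cs) = mset (concat ds)"
proof -
  have "mset (concat xs) = sum_mset (image_mset mset (mset xs))" for xs :: "'a list list"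
    by (induction xs) auto
  then show ?thesis using assms by simp
qed

text \<open>The order of the cells is irrelevant, but \<open>sift\<close> moves the cells around when it merges two of them.\<close>

lemma component_list_mset_cong:
  assumes "mset cs = mset ds"
  shows "component_list V F cs \<longleftrightarrow> component_list V F ds"
  using mset_concat_cong[OF assms] assms unfolding component_list_def
  by (metis mset_eq_imp_distinct_iff mset_eq_setD)

lemma set_cell_of:
  assumes "component_list V F cs" "x \<in> V"
  shows "set (cell_of x cs) = conn F `` {x}"
  using assms cell_of_mem[of x cs] by (auto simp: component_list_def)

lemma component_list_merge:
  assumes cs: "component_list V F (c # d # cs)" and u: "u \<in> set c" and v: "v \<in> set d"
  shows "component_list V (insert {u, v} F) ((c @ d) # cs)"
proof -
  let ?F = "insert {u, v} F"
  have c: "set c = conn F `` {u}" and d: "set d = conn F `` {v}"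
    using cs u v by (auto simp: component_list_def)
  have old: "set e = conn F `` {x}" if "e \<in> set cs" "x \<in> set e" for e x
    using cs that by (auto simp: component_list_def)
  have dist: "distinct (concat (c # d # cs))"
    using cs by (simp add: component_list_def)
  have merged: "set (c @ d) = conn ?F `` {x}" if x: "x \<in> set (c @ d)" for x
  proof (rule Set.set_eqI)
    fix y
    consider "(x, u) \<in> conn F" | "(x, v) \<in> conn F"
      using x c d conn_sym by fastforce
    then have "(x, y) \<in> conn ?F \<longleftrightarrow> (u, y) \<in> conn F \<or> (v, y) \<in> conn F"
      unfolding conn_insert by cases (meson conn_sym conn_trans)+
    then show "y \<in> set (c @ d) \<longleftrightarrow> y \<in> conn ?F `` {x}"
      by (simp add: c d)
  qed
  have unchanged: "set e = conn ?F `` {x}" if e: "e \<in> set cs" "x \<in> set e" for e x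
  proof -
    have "u \<notin> set e" "v \<notin> set e"
      using dist e u v by auto
    then have "(x, u) \<notin> conn F" "(x, v) \<notin> conn F"
      using old[OF e] by auto
    then have "conn ?F `` {x} = conn F `` {x}"
      by (auto simp: conn_insert)
    then show ?thesis using old[OF e] by simp
  qed
  show ?thesis
    using cs merged unchanged unfolding component_list_def by auto
qed

lemma component_list_singletons:
  assumes "distinct vs"
  shows "component_list (set vs) {} (singletons vs)"
proof -
  have eq: "singletons vs = map (\<lambda>v. [v]) vs" by (induction vs) auto
  have "conn {} = (Id :: ('a \<times> 'a) set)"
    by (auto simp: conn_def)
  then show ?thesis
    using assms by (auto simp: component_list_def eq)
qed

text \<open>An old edge bypassed with the help of the new edge would connect the ends of the new edge in the old
  forest.\<close>

lemma forest_insert: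
  assumes G: "simple_graph V T" and T: "T \<subseteq> bridges T" and uv: "(u, v) \<notin> conn T"
  shows "insert {u, v} T \<subseteq> bridges (insert {u, v} T)"
proof
  fix e assume e: "e \<in> insert {u, v} T"
  have vu: "(v, u) \<notin> conn T" using uv conn_sym[of v u T] by blast
  show "e \<in> bridges (insert {u, v} T)"
  proof (cases "e = {u, v}")
    case True
    have "(u, v) \<notin> conn (insert {u, v} T - {{u, v}})"
      using uv conn_mono[of "insert {u, v} T - {{u, v}}" T u v] by blast
    then show ?thesis
      unfolding True by (intro bridgeI) auto
  next
    case False
    with e have eT: "e \<in> T" by simp
    then obtain a b where ab: "e = {a, b}" "a \<noteq> b"
      using simple_graph_edge_obtain[OF G] by metis
    let ?T = "T - {e}"
    have "(a, b) \<notin> conn ?T" using bridgeD[of a b T] T eT ab by auto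
    moreover have "(x, y) \<in> conn T" if "(x, y) \<in> conn ?T" for x y
      using that by (rule conn_mono[rotated]) auto
    moreover have "(a, b) \<in> conn T" using eT ab by (intro conn_edge) auto
    ultimately have "(a, b) \<notin> conn (insert {u, v} ?T)"
      unfolding conn_insert using uv vu by (meson conn_sym conn_trans)
    moreover have "insert {u, v} T - {e} = insert {u, v} ?T" using False by auto
    ultimately show ?thesis
      using e ab by (intro bridgeI[of a b, folded ab(1)]) auto
  qed
qed

text \<open>The sum of the numbers of tree edges and of cells is constant, since each tree edge merges two
  cells. This bounds the number of tree edges by the number of vertices.\<close>

definition sift_inv :: "'a set \<Rightarrow> 'a list list \<Rightarrow> ('a \<times> 'a) list \<Rightarrow> ('a \<times> 'a) list \<Rightarrow> bool" where
  "sift_inv V cs ts ks \<longleftrightarrow> simple_graph V (und ` set ts) \<and> und ` set ts \<subseteq> bridges (und ` set ts) \<and>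
    component_list V (und ` set ts) cs \<and> length ts + length cs = card V \<and>
    (\<forall>(u, v)\<in>set ks. (u, v) \<in> conn (und ` set ts))"

lemma sift_inv_initial:
  assumes "distinct vs"
  shows "sift_inv (set vs) (singletons vs) [] []"
proof -
  have "length (singletons vs) = length vs" by (induction vs) auto
  then show ?thesis
    using component_list_singletons[OF assms] distinct_card[OF assms]
    by (simp add: sift_inv_def simple_graph_def)
qed

lemma sift_inv_cotree:
  assumes "sift_inv V cs ts ks" "u \<in> V" "v \<in> set (cell_of u cs)"
  shows "sift_inv V cs ts ((u, v) # ks)"
  using assms set_cell_of[of V _ cs u] by (auto simp: sift_inv_def)

lemma sift_inv_tree:
  assumes inv: "sift_inv V cs ts ks" and uv: "u \<in> V" "v \<in> V" "v \<notin> set (cell_of u cs)"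
  shows "sift_inv V ((cell_of u cs @ cell_of v cs) # drop_cell u (drop_cell v cs)) ((u, v) # ts) ks"
proof -
  let ?T = "und ` set ts" and ?c = "cell_of u cs" and ?d = "cell_of v cs"
    and ?r = "drop_cell u (drop_cell v cs)"
  have T: "simple_graph V ?T" "?T \<subseteq> bridges ?T" "component_list V ?T cs"
    and K: "\<And>u v. (u, v) \<in> set ks \<Longrightarrow> (u, v) \<in> conn ?T"
    using inv by (auto simp: sift_inv_def)
  have concat: "set (concat cs) = V" using T(3) by (simp add: component_list_def)
  have ncon: "(u, v) \<notin> conn ?T" using set_cell_of[OF T(3) uv(1)] uv(3) by simp
  then have "u \<notin> set ?d" using set_cell_of[OF T(3) uv(2)] conn_sym[of v u ?T] by auto
  then have cell: "cell_of u (drop_cell v cs) = ?c" by (rule cell_of_drop_cell)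
  have mv: "mset cs = add_mset ?d (mset (drop_cell v cs))"
    using mset_drop_cell[of v cs] uv(2) concat by blast
  then have "mset (concat cs) = mset ?d + mset (concat (drop_cell v cs))"
    using mset_concat_cong[of cs "?d # drop_cell v cs"] by simp
  then have "u \<in> set (concat (drop_cell v cs))"
    using uv(1) concat \<open>u \<notin> set ?d\<close> by (metis set_mset_mset set_mset_union Un_iff)
  from mset_drop_cell[OF this] have cs: "mset cs = mset (?c # ?d # ?r)"
    using mv cell by simp
  have "component_list V ?T (?c # ?d # ?r)"
    using T(3) component_list_mset_cong[OF cs] by blast
  then have "component_list V (insert {u, v} ?T) ((?c @ ?d) # ?r)"
    by (rule component_list_merge) (use cell_of_mem[of _ cs] uv(1,2) concat in blast)+
  moreover have "length ((u, v) # ts) + length ((?c @ ?d) # ?r) = card V"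
    using inv mset_eq_length[OF cs] by (simp add: sift_inv_def)
  moreover have "insert {u, v} ?T \<subseteq> bridges (insert {u, v} ?T)"
    using forest_insert[OF T(1,2) ncon] .
  moreover have "simple_graph V (insert {u, v} ?T)"
  proof -
    have "u \<noteq> v" using ncon by auto
    then show ?thesis using T(1) uv(1,2) by (auto simp: simple_graph_def)
  qed
  moreover have "(x, y) \<in> conn (insert {u, v} ?T)" if "(x, y) \<in> set ks" for x y
    using K[OF that] by (rule conn_mono[rotated]) auto
  moreover have "und ` set ((u, v) # ts) = insert {u, v} ?T"
    by (simp add: und_def)
  ultimately show ?thesis
    unfolding sift_inv_def by (simp only:) blast
qed

lemma sift_correct:
  assumes "sift_inv V cs ts ks" "set es \<subseteq> V \<times> V" "sift cs es ts ks = (ts', ks', cs')"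
  shows "sift_inv V cs' ts' ks' \<and> mset (ts' @ ks') = mset (ts @ ks @ es)"
  using assms
proof (induction cs es ts ks rule: sift.induct)
  case (2 cs u v es ts ks)
  have uv: "u \<in> V" "v \<in> V" using 2(4) by auto
  show ?case
  proof (cases "v \<in> set (cell_of u cs)")
    case True
    then show ?thesis
      using 2(1)[OF refl] 2(4,5) sift_inv_cotree[OF 2(3) uv(1) True] by (simp add: Let_def)
  next
    case False
    then show ?thesis
      using 2(2)[OF refl] 2(4,5) sift_inv_tree[OF 2(3) uv False] by (simp add: Let_def)
  qed
qed simp

text \<open>The co-tree edges do not contribute to the connectivity, so the final cells are the components with
  respect to all edges that were sifted.\<close>

lemma sift_components:
  assumes vs: "distinct vs" "set es \<subseteq> set vs \<times> set vs"
    and s: "sift (singletons vs) es [] [] = (ts, ks, cs)"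
  shows "sift_inv (set vs) cs ts ks" "mset (ts @ ks) = mset es"
    and "conn (und ` set ts) = conn (und ` set es)" "component_list (set vs) (und ` set es) cs"
proof -
  show inv: "sift_inv (set vs) cs ts ks" and mset: "mset (ts @ ks) = mset es"
    using sift_correct[OF sift_inv_initial[OF vs(1)] vs(2) s] by auto
  then have set: "set es = set ts \<union> set ks"
    by (metis mset_eq_setD set_append)
  show conn: "conn (und ` set ts) = conn (und ` set es)"
  proof (rule conn_eqI)
    show "(x, y) \<in> conn (und ` set es)" if "{x, y} \<in> und ` set ts" for x y
      using that set by (intro conn_edge) auto
    show "(x, y) \<in> conn (und ` set ts)" if xy: "{x, y} \<in> und ` set es" for x y
    proof (cases "{x, y} \<in> und ` set ts")
      case False
      with xy set have "{x, y} \<in> und ` set ks" by auto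
      then have "(x, y) \<in> set ks \<or> (y, x) \<in> set ks"
        by (auto simp: und_def doubleton_eq_iff)
      then show ?thesis
        using inv conn_sym[of y x] by (auto simp: sift_inv_def)
    qed (rule conn_edge)
  qed
  show "component_list (set vs) (und ` set es) cs"
    using inv unfolding sift_inv_def component_list_def conn by blast
qed

section \<open>Computing the Tucker representation\<close>

lemma set_number: "set (number k es) = {(k + i, es ! i) | i. i < length es}"
proof (induction es arbitrary: k)
  case (Cons e es)
  have "{(k + i, (e # es) ! i) | i. i < length (e # es)} = insert (k, e) {(Suc k + i, es ! i) | i. i < length es}"
    (is "?L = ?R")
  proof
    show "?L \<subseteq> ?R"
    proof
      fix z assume "z \<in> ?L"
      then obtain i where "z = (k + i, (e # es) ! i)" "i < length (e # es)" by blast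
      then show "z \<in> ?R" by (cases i) auto
    qed
    show "?R \<subseteq> ?L" by force
  qed
  with Cons show ?case by simp
qed simp

lemma number_nth: "(k, e) \<in> set (number 0 ts) \<longleftrightarrow> k < length ts \<and> e = ts ! k"
  by (auto simp: set_number)

lemma length_number [simp]: "length (number k es) = length es"
  by (induction es arbitrary: k) auto

lemma distinct_number: "distinct (number k es)"
  by (induction es arbitrary: k) (auto simp: set_number)

lemma set_at_eq: "set_at k s x = x[k := s]"
  by (induction k s x rule: set_at.induct) auto

lemma zeros_eq: "zeros es = replicate (length es) 0"
  by (induction es) auto

text \<open>The list \<open>ps\<close> holds the labels assigned so far, \<open>es\<close> the numbered tree edges not yet used. The last
  conjunct is the potential property: along a used edge the label changes by the unit vector of that
  edge. Reachability by used edges and zero entries at unused ones are what preserves it when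
  another edge is used.\<close>

definition labelling :: "('a \<times> 'a) list \<Rightarrow> 'a \<Rightarrow> ('a \<times> int list) list \<Rightarrow> (nat \<times> 'a \<times> 'a) list \<Rightarrow> bool" where
  "labelling ts r0 ps es \<longleftrightarrow>
    distinct (map fst ps) \<and> r0 \<in> fst ` set ps \<and> distinct es \<and> set es \<subseteq> set (number 0 ts) \<and>
    (\<forall>(v, x)\<in>set ps. length x = length ts \<and> (r0, v) \<in> conn (und ` snd ` (set (number 0 ts) - set es)) \<and>
      (\<forall>(k, e)\<in>set es. x ! k = 0)) \<and>
    (\<forall>(k, a, b)\<in>set (number 0 ts) - set es.
      \<exists>x y. (a, x) \<in> set ps \<and> (b, y) \<in> set ps \<and> y = x[k := x ! k + 1])"

lemma labelling_used:
  assumes "labelling ts r0 ps es" "(k, a, b) \<in> set (number 0 ts)" "(k, a, b) \<notin> set es"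
  obtains x where "(a, x) \<in> set ps" "(b, x[k := x ! k + 1]) \<in> set ps"
proof -
  have "\<forall>(k, a, b)\<in>set (number 0 ts) - set es.
      \<exists>x y. (a, x) \<in> set ps \<and> (b, y) \<in> set ps \<and> y = x[k := x ! k + 1]"
    using assms(1) unfolding labelling_def by (elim conjE)
  from bspec[OF this, of "(k, a, b)"] assms(2,3) that show ?thesis by auto
qed

lemma labelling_cong:
  assumes "mset ps = mset qs" "mset es = mset fs"
  shows "labelling ts r0 ps es \<longleftrightarrow> labelling ts r0 qs fs"
proof -
  have "mset (map fst ps) = mset (map fst qs)" using assms by simp
  from mset_eq_imp_distinct_iff[OF this] mset_eq_imp_distinct_iff[OF assms(2)] show ?thesis
    unfolding labelling_def mset_eq_setD[OF assms(1)] mset_eq_setD[OF assms(2)] by simp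
qed

text \<open>The new vertex \<open>w\<close> has no label yet: otherwise used edges would connect both ends of the unused edge, which
  is a bridge of the tree. As the label of \<open>v\<close> is zero at this edge, overwriting its entry with
  1 or - 1 amounts to adding or subtracting the unit vector.\<close>

lemma labelling_expand:
  assumes L: "labelling ts r0 ps ((k, a, b) # es)"
    and forest: "distinct (map und ts)" "und ` set ts \<subseteq> bridges (und ` set ts)" "a \<noteq> b"
    and vx: "(v, x) \<in> set ps"
    and w: "a = v \<and> w = b \<and> y = x[k := 1] \<or> b = v \<and> w = a \<and> y = x[k := - 1]"
  shows "labelling ts r0 ((w, y) # ps) es"
proof -
  let ?N = "set (number 0 ts)"
  let ?U = "?N - set ((k, a, b) # es)" and ?U' = "?N - set es"
  have N: "(k, a, b) \<in> ?N" and new: "(k, a, b) \<notin> set es" and dist: "distinct (map fst ps)" "distinct es"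
    and sub: "set es \<subseteq> ?N"
    using L by (auto simp: labelling_def)
  have k: "k < length ts" "ts ! k = (a, b)" using N by (auto simp: number_nth)
  have U': "?U' = insert (k, a, b) ?U" using N new by auto
  have len: "length z = length ts" and reach: "(r0, u) \<in> conn (und ` snd ` ?U)"
    and zero: "(k', e) \<in> set ((k, a, b) # es) \<Longrightarrow> z ! k' = 0"
    if "(u, z) \<in> set ps" for u z k' e
    using L that unfolding labelling_def by fast+
  have used: "\<exists>x y. (a', x) \<in> set ps \<and> (b', y) \<in> set ps \<and> y = x[k' := x ! k' + 1]"
    if "(k', a', b') \<in> ?U" for k' a' b'
    using labelling_used[OF L, of k' a' b'] that by (metis DiffD1 DiffD2)
  have U_sub: "und ` snd ` ?U \<subseteq> und ` set ts - {{a, b}}"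
  proof
    fix f assume "f \<in> und ` snd ` ?U"
    then obtain k' e where ke: "(k', e) \<in> ?U" "f = und e" by force
    then have k': "k' < length ts" "e = ts ! k'" by (auto simp: number_nth)
    have "k' \<noteq> k" using ke k k' by auto
    then have "und (ts ! k') \<noteq> und (ts ! k)"
      using forest(1) k(1) k'(1) by (simp add: distinct_conv_nth)
    then show "f \<in> und ` set ts - {{a, b}}"
      using ke(2) k k' by (auto simp: und_def)
  qed
  have vw: "{v, w} = {a, b}" using w by auto
  have w_new: "w \<notin> fst ` set ps"
  proof
    assume "w \<in> fst ` set ps"
    then obtain z where "(w, z) \<in> set ps" by auto
    then have "(v, w) \<in> conn (und ` snd ` ?U)"
      using reach[OF vx] reach by (meson conn_sym conn_trans)
    then have "(a, b) \<in> conn (und ` snd ` ?U)"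
      using w conn_sym[of b a] by auto
    then have "(a, b) \<in> conn (und ` set ts - {{a, b}})"
      using U_sub conn_mono by metis
    moreover have "und (ts ! k) \<in> und ` set ts" using k(1) by simp
    then have "{a, b} \<in> und ` set ts" using k(2) by (simp add: und_def)
    ultimately show False
      using bridgeD[of a b "und ` set ts"] forest(2,3) by auto
  qed
  have edge: "und ` snd ` ?U' = insert {a, b} (und ` snd ` ?U)"
    unfolding U' by (simp add: und_def)
  have reach': "(r0, u) \<in> conn (und ` snd ` ?U')" if "(r0, u) \<in> conn (und ` snd ` ?U)" for u
    using that unfolding edge by (rule conn_mono[rotated]) auto
  have "(v, w) \<in> conn (und ` snd ` ?U')"
    unfolding edge by (rule conn_edge) (simp add: vw)
  then have w_conn: "(r0, w) \<in> conn (und ` snd ` ?U')"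
    using reach'[OF reach[OF vx]] conn_trans by metis
  have x: "length x = length ts" "x ! k = 0" using len[OF vx] zero[OF vx] by auto
  have y_zero: "y ! k' = 0" if "(k', e) \<in> set es" for k' e
  proof -
    have "k' \<noteq> k" using that new sub k N by (auto simp: number_nth)
    moreover have "x ! k' = 0" using zero[OF vx, of k' e] that by simp
    ultimately show ?thesis using w by auto
  qed
  have y_len: "length y = length ts" using w x by auto
  have y_edge: "\<exists>x' y'. (a, x') \<in> set ((w, y) # ps) \<and> (b, y') \<in> set ((w, y) # ps) \<and> y' = x'[k := x' ! k + 1]"
    using w
  proof
    assume "a = v \<and> w = b \<and> y = x[k := 1]"
    then show ?thesis using vx x by (intro exI[of _ x] exI[of _ y]) auto
  next
    assume "b = v \<and> w = a \<and> y = x[k := - 1]"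
    then show ?thesis
      using vx x k(1) list_update_id[of x k] by (intro exI[of _ y] exI[of _ x]) (simp add: x(2)[symmetric])
  qed
  show ?thesis
    unfolding labelling_def
  proof (intro conjI ballI)
    show "distinct (map fst ((w, y) # ps))" "r0 \<in> fst ` set ((w, y) # ps)" "distinct es" "set es \<subseteq> ?N"
      using dist sub w_new L by (auto simp: labelling_def)
  next
    fix p assume p: "p \<in> set ((w, y) # ps)"
    obtain u z where uz: "p = (u, z)" by force
    show "case p of (v, x) \<Rightarrow> length x = length ts \<and> (r0, v) \<in> conn (und ` snd ` ?U') \<and>
        (\<forall>(k, e)\<in>set es. x ! k = 0)"
    proof (cases "p = (w, y)")
      case True
      then show ?thesis using w_conn y_len y_zero by auto
    next
      case False
      with p uz have "(u, z) \<in> set ps" by auto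
      then show ?thesis using len reach'[OF reach] zero uz by fastforce
    qed
  next
    fix t assume t: "t \<in> ?U'"
    obtain k' a' b' where t': "t = (k', a', b')" by (cases t)
    show "case t of (k, a, b) \<Rightarrow>
        \<exists>x' y'. (a, x') \<in> set ((w, y) # ps) \<and> (b, y') \<in> set ((w, y) # ps) \<and> y' = x'[k := x' ! k + 1]"
    proof (cases "t = (k, a, b)")
      case True
      then show ?thesis using y_edge by simp
    next
      case False
      then have "(k', a', b') \<in> ?U" using t t' by auto
      from used[OF this] show ?thesis unfolding t' prod.case by (meson list.set_intros(2))
    qed
  qed
qed

lemma expand_labelling:
  assumes "labelling ts r0 ((v, x) # work @ ps) (es @ rest)"
    and forest: "distinct (map und ts)" "und ` set ts \<subseteq> bridges (und ` set ts)"
      "\<And>a b. (a, b) \<in> set ts \<Longrightarrow> a \<noteq> b"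
    and "expand v x es work rest = (work', es')"
  shows "labelling ts r0 ((v, x) # work' @ ps) es' \<and> set es' \<subseteq> set es \<union> set rest \<and>
    (\<forall>(k, a, b)\<in>set es'. (k, a, b) \<in> set rest \<or> a \<noteq> v \<and> b \<noteq> v)"
  using assms(1,5)
proof (induction v x es work rest rule: expand.induct)
  case (2 v x k a b es work rest)
  let ?es = "((k, a, b) # es) @ rest"
  have "(a, b) \<in> set ts"
    using 2(4) by (auto simp: labelling_def number_nth)
  then have "a \<noteq> b" by (rule forest(3))
  have step: "labelling ts r0 ((v, x) # ((w, y) # work) @ ps) (es @ rest)"
    if "a = v \<and> w = b \<and> y = set_at k 1 x \<or> b = v \<and> w = a \<and> y = set_at k (- 1) x" for w y
  proof -
    have "labelling ts r0 ((w, y) # (v, x) # work @ ps) (es @ rest)"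
      by (rule labelling_expand[OF _ forest(1,2) \<open>a \<noteq> b\<close>])
         (use 2(4) that in \<open>auto simp: set_at_eq\<close>)
    then show ?thesis
      by (subst (asm) labelling_cong) auto
  qed
  have skip: "labelling ts r0 ((v, x) # work @ ps) (es @ (k, a, b) # rest)"
    using 2(4) by (subst (asm) labelling_cong) auto
  consider (head) "a = v" | (tail) "a \<noteq> v" "b = v" | (none) "a \<noteq> v" "b \<noteq> v" by blast
  then show ?case
  proof cases
    case head
    then show ?thesis using 2(1)[OF head step] 2(5) by auto
  next
    case tail
    then show ?thesis using 2(2)[OF tail step] 2(5) by auto
  next
    case none
    then show ?thesis using 2(3)[OF none skip] 2(5) by auto
  qed
qed auto

text \<open>When the traversal stops, every tree edge is used: either nothing is left to expand, so that
  the labelled vertices are closed under adjacency, or every vertex has been expanded.\<close>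

lemma traverse_labelling:
  assumes "labelling ts r0 (ps @ work) es"
    and ts: "distinct (map und ts)" "simple_graph V (und ` set ts)" "und ` set ts \<subseteq> bridges (und ` set ts)"
      "connected_graph V (und ` set ts)" "r0 \<in> V"
    and "\<forall>(k, a, b)\<in>set es. a \<notin> fst ` set ps \<and> b \<notin> fst ` set ps"
    and "length fuel + length ps = card V"
  shows "labelling ts r0 (ps @ traverse fuel work es) [] \<and> fst ` set (ps @ traverse fuel work es) = V"
proof -
  let ?T = "und ` set ts"
  have ne: "a \<noteq> b" if "(a, b) \<in> set ts" for a b
    using simple_graph_edge(3)[OF ts(2), of a b] imageI[OF that, of und] by (simp add: und_def)
  have finV: "finite V" using ts(2) by (simp add: simple_graph_def)
  have sub: "fst ` set L \<subseteq> V" if "labelling ts r0 L es" for L es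
  proof
    fix u assume "u \<in> fst ` set L"
    then have "(r0, u) \<in> conn (und ` snd ` (set (number 0 ts) - set es))"
      using that by (fastforce simp: labelling_def)
    then have "(r0, u) \<in> conn ?T"
      by (rule conn_mono[rotated]) (auto simp: number_nth)
    then show "u \<in> V"
      by (rule conn_invariant) (fact ts(5), erule simple_graph_edge(2)[OF ts(2)])
  qed
  have num: "(k, a, b) \<in> set (number 0 ts) \<Longrightarrow> a \<in> V \<and> b \<in> V" for k a b
  proof -
    assume "(k, a, b) \<in> set (number 0 ts)"
    then have "(a, b) \<in> set ts" by (auto simp: number_nth)
    then show "a \<in> V \<and> b \<in> V"
      using simple_graph_edge(1,2)[OF ts(2), of a b] imageI[of "(a, b)" "set ts" und] by (simp add: und_def)
  qed
  have finish: "es = []"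
    if "labelling ts r0 L es" "\<forall>(k, a, b)\<in>set es. a \<notin> V \<and> b \<notin> V" for L es
    using that num by (cases es) (auto simp: labelling_def)
  show ?thesis
    using assms(1,7,8)
  proof (induction fuel work es arbitrary: ps rule: traverse.induct)
    case (1 work es)
    have L: "labelling ts r0 (ps @ work) es" using 1(1) .
    have dist: "distinct (map fst (ps @ work))" using L by (simp add: labelling_def)
    then have "card (fst ` set ps) = card V"
      using 1(3) distinct_card[of "map fst ps"] by simp
    moreover have "fst ` set ps \<subseteq> V" using sub[OF L] by auto
    ultimately have V: "fst ` set ps = V" by (intro card_subset_eq finV) auto
    then have "work = []"
      using dist sub[OF L] by (cases work) auto
    moreover have "es = []" using finish[OF L] 1(2) V by simp
    ultimately show ?case using L V by simp
  next
    case (2 f fuel es)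
    have L: "labelling ts r0 ps es" using 2(1) by simp
    have "v \<in> fst ` set ps" if "v \<in> V" for v
    proof -
      have "(r0, v) \<in> conn ?T"
        using ts(4,5) that connected_graph_iff[OF ts(2)] by blast
      moreover have "r0 \<in> fst ` set ps" using L by (simp add: labelling_def)
      ultimately show ?thesis
      proof (rule conn_invariant)
        fix y z assume yz: "{y, z} \<in> ?T" "y \<in> fst ` set ps"
        then obtain e where "e \<in> set ts" "und e = {y, z}" by (metis imageE)
        then obtain k where k: "(k, e) \<in> set (number 0 ts)"
          by (metis in_set_conv_nth number_nth)
        obtain a b where e: "e = (a, b)" by force
        then have ab: "{a, b} = {y, z}" using \<open>und e = {y, z}\<close> by (simp add: und_def)
        have "(k, a, b) \<notin> set es" using 2(2) yz(2) ab by (auto simp: doubleton_eq_iff)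
        then obtain x where "(a, x) \<in> set ps" "(b, x[k := x ! k + 1]) \<in> set ps"
          using labelling_used[OF L] k e by metis
        then have "a \<in> fst ` set ps \<and> b \<in> fst ` set ps"
          by (simp add: rev_image_eqI)
        then show "z \<in> fst ` set ps" using ab by (auto simp: doubleton_eq_iff)
      qed
    qed
    then have V: "fst ` set ps = V" using sub[OF L] by blast
    have "es = []" using finish[OF L] 2(2) V by simp
    then show ?case using L V by simp
  next
    case (3 f fuel v x work es)
    obtain work' es' where ex: "expand v x es work [] = (work', es')" by force
    have "labelling ts r0 ((v, x) # work @ ps) (es @ [])"
      using 3(2) by (subst (asm) labelling_cong) auto
    from expand_labelling[OF this ts(1,3) ne ex]
    have L: "labelling ts r0 ((v, x) # work' @ ps) es'" "set es' \<subseteq> set es"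
        "\<forall>(k, a, b)\<in>set es'. a \<noteq> v \<and> b \<noteq> v"
      by auto
    have "labelling ts r0 ((ps @ [(v, x)]) @ work') es'"
      using L(1) by (subst (asm) labelling_cong) auto
    moreover have "\<forall>(k, a, b)\<in>set es'. a \<notin> fst ` set (ps @ [(v, x)]) \<and> b \<notin> fst ` set (ps @ [(v, x)])"
      using 3(3) L(2,3) by fastforce
    moreover have "length fuel + length (ps @ [(v, x)]) = card V" using 3(4) by simp
    ultimately have "labelling ts r0 ((ps @ [(v, x)]) @ traverse fuel work' es') [] \<and>
        fst ` set ((ps @ [(v, x)]) @ traverse fuel work' es') = V"
      by (rule 3(1)[OF ex[symmetric]])
    then show ?case using ex by simp
  qed
qed

text \<open>Summing the potential differences along a path gives its sign at the edge in question, because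
  a path uses no edge twice.\<close>

lemma potential_difference:
  fixes f :: "'a \<Rightarrow> int"
  assumes "distinct p" "p \<noteq> []"
    and "\<And>u v. (u, v) \<in> set (zip p (tl p)) \<Longrightarrow> f v - f u = (if (u, v) = e then 1 else if (v, u) = e then - 1 else 0)"
  shows "f (last p) - f (hd p) = path_sign p e"
  using assms
proof (induction p rule: induct_list012)
  case (3 u w q)
  obtain a b where e: "e = (a, b)" by force
  have step: "f w - f u = (if (u, w) = e then 1 else if (w, u) = e then - 1 else 0)"
    by (rule 3(5)) simp
  have "f (last (w # q)) - f (hd (w # q)) = path_sign (w # q) e"
    by (rule 3(2)) (use 3(3,5) in auto)
  moreover have fresh: "x \<noteq> u \<and> y \<noteq> u" if "(x, y) \<in> set (zip (w # q) q)" for x y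
    using that 3(3) set_zip_leftD[OF that] set_zip_rightD[OF that] by auto
  moreover have "path_sign (u # w # q) e =
      (if (u, w) = e then 1 else if (w, u) = e then - 1 else path_sign (w # q) e)"
    using 3(3) fresh[of a b] fresh[of b a] by (auto simp: path_sign_def e)
  moreover have "path_sign (w # q) e = 0" if "(u, w) = e \<or> (w, u) = e"
    using that fresh[of a b] fresh[of b a] by (auto simp: path_sign_def e)
  ultimately show ?case
    using step by (auto split: if_splits)
qed (auto simp: path_sign_def)

lemma lookup_eq: "distinct (map fst ps) \<Longrightarrow> (v, x) \<in> set ps \<Longrightarrow> lookup v ps = x"
  by (induction ps rule: lookup.induct) force+

lemma diff_eq: "diff xs ys = map2 (-) xs ys"
  by (induction xs ys rule: diff.induct) auto

lemma columns_eq: "columns ps ks = map (\<lambda>(h, t). diff (lookup t ps) (lookup h ps)) ks"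
  by (induction ps ks rule: columns.induct) auto

text \<open>The definition of \<open>tucker_columns\<close> subtracts root labels. Once the labels are known to be
  potentials, no reference to root paths remains.\<close>

lemma tucker_columns_correct:
  assumes G: "simple_graph V E" and T: "spanning_tree V E (und ` set ts)"
    and ts: "distinct (map und ts)" and ks: "set ks \<subseteq> V \<times> V"
    and vs: "distinct vs" "set vs = V"
  shows "mat_of_cols_list (length ts) (tucker_columns vs ts ks) = tucker V ts ks"
    and "\<forall>c\<in>set (tucker_columns vs ts ks). length c = length ts"
proof -
  let ?T = "und ` set ts"
  note T' = spanning_treeD[OF G T]
  obtain r0 vs' where v: "vs = r0 # vs'"
    using T'(4) vs(2) by (cases vs) (auto simp: connected_graph_def)
  define ps where "ps = traverse vs [(r0, zeros ts)] (number 0 ts)"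
  have cols: "tucker_columns vs ts ks = map (\<lambda>(h, t). diff (lookup t ps) (lookup h ps)) ks"
    by (simp add: v ps_def columns_eq)
  have "labelling ts r0 ([] @ [(r0, zeros ts)]) (number 0 ts)"
    by (auto simp: labelling_def distinct_number zeros_eq number_nth)
  moreover have "r0 \<in> V" "length vs + length [] = card V"
    using v vs distinct_card[OF vs(1)] by auto
  ultimately have "labelling ts r0 ([] @ ps) [] \<and> fst ` set ([] @ ps) = V"
    unfolding ps_def by (intro traverse_labelling[OF _ ts T'(2,3,4)]) auto
  then have ps: "labelling ts r0 ps []" "fst ` set ps = V"
    by auto
  have dist: "distinct (map fst ps)" using ps(1) by (simp add: labelling_def)
  have lookup: "(u, lookup u ps) \<in> set ps" if u: "u \<in> V" for u
  proof -
    obtain x where "(u, x) \<in> set ps" using u ps(2) by force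
    with lookup_eq[OF dist this] show ?thesis by simp
  qed
  have len: "length (lookup u ps) = length ts" if "u \<in> V" for u
    using lookup[OF that] ps(1) by (auto simp: labelling_def)
  have step: "lookup b ps = (lookup a ps)[k := lookup a ps ! k + 1]"
    if step_k: "k < length ts" "ts ! k = (a, b)" for k a b
  proof -
    obtain x where "(a, x) \<in> set ps" "(b, x[k := x ! k + 1]) \<in> set ps"
      by (rule labelling_used[OF ps(1), of k a b]) (use step_k in \<open>auto simp: number_nth\<close>)
    with lookup_eq[OF dist] show ?thesis by metis
  qed
  have entry: "lookup t ps ! i - lookup h ps ! i = path_sign (tree_path V ?T h t) (ts ! i)"
    if ht: "h \<in> V" "t \<in> V" and i: "i < length ts" for h t i
  proof -
    let ?p = "tree_path V ?T h t" and ?f = "\<lambda>v. lookup v ps ! i"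
    note p = spanning_tree_path[OF G T ht]
    have "?f (last ?p) - ?f (hd ?p) = path_sign ?p (ts ! i)"
    proof (rule potential_difference)
      show "distinct ?p" "?p \<noteq> []" using p(1) by (auto simp: path_def)
      fix u v assume "(u, v) \<in> set (zip ?p (tl ?p))"
      then have uvT: "{u, v} \<in> ?T" using p(1) by (auto simp: path_def successively_zip)
      have uvV: "u \<in> V" "v \<in> V" "u \<noteq> v" using simple_graph_edge[OF T'(2) uvT] by auto
      obtain k where k: "k < length ts" "und (ts ! k) = {u, v}"
        using uvT by (metis (no_types, lifting) image_iff in_set_conv_nth)
      then have k': "ts ! k = (u, v) \<or> ts ! k = (v, u)"
        by (cases "ts ! k") (auto simp: und_def doubleton_eq_iff)
      have same: "e = ts ! i \<longleftrightarrow> k = i \<and> e = ts ! k" if "und e = {u, v}" for e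
        using that ts k i by (metis distinct_conv_nth length_map nth_map)
      have change: "?f b - ?f a = (if k = i then 1 else 0)" if e: "ts ! k = (a, b)" and a: "a \<in> V" for a b
        unfolding step[OF k(1) e] using len[OF a] i by simp
      show "?f v - ?f u = (if (u, v) = ts ! i then 1 else if (v, u) = ts ! i then - 1 else 0)"
        using k'
      proof
        assume e: "ts ! k = (u, v)"
        have "(u, v) = ts ! i \<longleftrightarrow> k = i" "(v, u) = ts ! i \<longleftrightarrow> False"
          using same[of "(u, v)"] same[of "(v, u)"] e uvV(3) by (auto simp: und_def)
        then show ?thesis using change[OF e uvV(1)] by simp
      next
        assume e: "ts ! k = (v, u)"
        have "(v, u) = ts ! i \<longleftrightarrow> k = i" "(u, v) = ts ! i \<longleftrightarrow> False"
          using same[of "(v, u)"] same[of "(u, v)"] e uvV(3) by (auto simp: und_def)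
        then show ?thesis using change[OF e uvV(2)] by (auto split: if_splits)
      qed
    qed
    then show ?thesis using p by simp
  qed
  have len_diff: "length (diff (lookup t ps) (lookup h ps)) = length ts" if "(h, t) \<in> set ks" for h t
    using ks that len by (auto simp: diff_eq)
  then show "\<forall>c\<in>set (tucker_columns vs ts ks). length c = length ts"
    by (auto simp: cols)
  show "mat_of_cols_list (length ts) (tucker_columns vs ts ks) = tucker V ts ks"
  proof (rule eq_matI)
    fix i j assume ij: "i < dim_row (tucker V ts ks)" "j < dim_col (tucker V ts ks)"
    then have i: "i < length ts" and j: "j < length ks" by (auto simp: tucker_def)
    obtain h t where ht: "ks ! j = (h, t)" by force
    then have V: "h \<in> V" "t \<in> V" using ks nth_mem[OF j] by auto
    show "mat_of_cols_list (length ts) (tucker_columns vs ts ks) $$ (i, j) = tucker V ts ks $$ (i, j)"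
      using i j ht V entry[OF V i] len
      by (simp add: mat_of_cols_list_def tucker_def cols diff_eq)
  qed (auto simp: mat_of_cols_list_def tucker_def cols)
qed

section \<open>Choosing zero rows and contracting\<close>

lemma length_and_zero: "length (and_zero zs xs) = min (length zs) (length xs)"
  by (induction zs xs rule: and_zero.induct) auto

lemma nth_and_zero:
  "i < length zs \<Longrightarrow> i < length xs \<Longrightarrow> and_zero zs xs ! i \<longleftrightarrow> zs ! i \<and> xs ! i = 0"
  by (induction zs xs arbitrary: i rule: and_zero.induct) (auto simp: nth_Cons split: nat.splits)

lemma zero_flags_correct:
  assumes "\<forall>c\<in>set cs. length c = length zs"
  shows "length (zero_flags zs cs) = length zs \<and>
    (\<forall>i<length zs. zero_flags zs cs ! i \<longleftrightarrow> zs ! i \<and> (\<forall>c\<in>set cs. c ! i = 0))"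
  using assms
proof (induction zs cs rule: zero_flags.induct)
  case (2 zs c cs)
  then show ?case by (auto simp: length_and_zero nth_and_zero)
qed auto

lemma trues_eq: "trues es = replicate (length es) True"
  by (induction es) auto

lemma flagged_eq: "flagged es zs = map fst (filter snd (zip es zs))"
  by (induction es zs rule: flagged.induct) auto

lemma flagged_subset: "set (flagged es zs) \<subseteq> set es"
  by (induction es zs rule: flagged.induct) auto

lemma chosen_rows:
  assumes "\<forall>c\<in>set M. length c = length ts"
  defines "fl \<equiv> flagged ts (zero_flags (trues ts) M)"
  shows "und ` set fl = {und (ts ! k) | k. k < dim_row (mat_of_cols_list (length ts) M) \<and>
      row (mat_of_cols_list (length ts) M) k = 0\<^sub>v (dim_col (mat_of_cols_list (length ts) M))}"
    and "distinct (map und ts) \<Longrightarrow> distinct (map und fl)" and "length fl \<le> length ts"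
proof -
  let ?z = "zero_flags (trues ts) M"
  have len: "length ?z = length ts" and z: "\<And>i. i < length ts \<Longrightarrow> ?z ! i \<longleftrightarrow> (\<forall>c\<in>set M. c ! i = 0)"
    using zero_flags_correct[of M "trues ts"] assms(1) by (auto simp: trues_eq)
  have row: "row (mat_of_cols_list (length ts) M) k = 0\<^sub>v (length M) \<longleftrightarrow> (\<forall>c\<in>set M. c ! k = 0)"
    if "k < length ts" for k
    using that by (auto simp: vec_eq_iff mat_of_cols_list_def all_set_conv_all_nth)
  have "set fl = {ts ! k | k. k < length ts \<and> (\<forall>c\<in>set M. c ! k = 0)}"
  proof -
    have "set (flagged ts zs) = {ts ! k | k. k < length ts \<and> zs ! k}" if "length zs = length ts" for zs
      unfolding flagged_eq set_map set_filter set_zip using that by force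
    from this[OF len] show ?thesis
      unfolding fl_def using z by auto
  qed
  then have "und ` set fl = {und (ts ! k) | k. k < length ts \<and> (\<forall>c\<in>set M. c ! k = 0)}"
    by (simp add: setcompr_eq_image image_image)
  also have "\<dots> = {und (ts ! k) | k. k < length ts \<and> row (mat_of_cols_list (length ts) M) k = 0\<^sub>v (length M)}"
    using row by blast
  finally show "und ` set fl = {und (ts ! k) | k. k < dim_row (mat_of_cols_list (length ts) M) \<and>
      row (mat_of_cols_list (length ts) M) k = 0\<^sub>v (dim_col (mat_of_cols_list (length ts) M))}"
    by (simp add: mat_of_cols_list_def)
  show "distinct (map und fl)" if d: "distinct (map und ts)"
  proof -
    have "distinct (map (und \<circ> fst) (zip ts ?z))"
      using d len by (simp flip: map_map)
    then have "distinct (map (und \<circ> fst) (filter snd (zip ts ?z)))"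
      by (rule distinct_map_filter)
    then show ?thesis by (simp add: fl_def flagged_eq)
  qed
  show "length fl \<le> length ts"
    using length_filter_le[of snd "zip ts ?z"] len by (simp add: fl_def flagged_eq)
qed

lemma links_eq:
  "links cs es = map (\<lambda>(u, v). (cell_of u cs, cell_of v cs)) (filter (\<lambda>(u, v). v \<notin> set (cell_of u cs)) es)"
  by (induction cs es rule: links.induct) (auto simp: Let_def)

text \<open>No two links coincide, since contracting bridges creates no parallel edges.\<close>

lemma contract_represents:
  assumes G: "simple_graph V E" and rep: "represents vs es V E"
    and fs: "set fs \<subseteq> set es" and F: "und ` set fs \<subseteq> bridges E"
    and c: "contract vs es fs = (cells, ls)"
  shows "represents (map set cells) (map (map_prod set set) ls)
    (edge_partition V (und ` set fs)) (contract_edges (edge_partition V (und ` set fs)) E)"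
proof -
  let ?F = "und ` set fs" and ?P = "edge_partition V (und ` set fs)"
  have vs: "distinct vs" "set vs = V" and es: "distinct (map und es)" "und ` set es = E"
    using rep by (auto simp: represents_def oriented_list_def)
  have FE: "?F \<subseteq> E" using F bridges_subset by blast
  have esE: "{u, v} \<in> E" if "(u, v) \<in> set es" for u v
    using imageI[OF that, of und] es(2) by (simp add: und_def)
  have esV: "u \<in> V \<and> v \<in> V" if "(u, v) \<in> set es" for u v
    using simple_graph_edge[OF G esE[OF that]] by blast
  obtain ts ks where sift: "sift (singletons vs) fs [] [] = (ts, ks, cells)" and ls: "ls = links cells es"
    using c by (auto split: prod.splits)
  have "set fs \<subseteq> set vs \<times> set vs" using fs esV vs(2) by auto
  from sift_components(4)[OF vs(1) this sift]
  have cells: "component_list V ?F cells" using vs(2) by simp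
  have cell: "set (cell_of u cells) = conn ?F `` {u}" if "u \<in> V" for u
    using set_cell_of[OF cells that] .
  have P: "?P = (\<lambda>x. conn ?F `` {x}) ` V"
    using edge_partition_eq[OF simple_graph_subset[OF G FE]] .
  have "distinct (map set cells)"
  proof -
    have "distinct (concat cells)" "[] \<notin> set cells"
      using cells by (auto simp: component_list_def)
    then have "distinct cells" and disj: "\<And>c d. c \<in> set cells \<Longrightarrow> d \<in> set cells \<Longrightarrow> c \<noteq> d \<Longrightarrow> set c \<inter> set d = {}"
      by (auto simp: distinct_concat_iff)
    moreover have "c = d" if "c \<in> set cells" "d \<in> set cells" "set c = set d" for c d
      using disj[OF that(1,2)] that \<open>[] \<notin> set cells\<close> by (cases c) auto
    ultimately show ?thesis
      by (simp add: distinct_map inj_on_def)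
  qed
  moreover have "set (map set cells) = ?P"
  proof
    show "set (map set cells) \<subseteq> ?P"
    proof
      fix C assume "C \<in> set (map set cells)"
      then obtain c where c: "c \<in> set cells" "C = set c" by auto
      then have "c \<noteq> []" using cells by (auto simp: component_list_def)
      then obtain x where x: "x \<in> set c" by (meson last_in_set)
      then have "C = conn ?F `` {x}" "x \<in> V"
        using cells c by (auto simp: component_list_def)
      then show "C \<in> ?P" by (simp add: P)
    qed
    show "?P \<subseteq> set (map set cells)"
    proof
      fix C assume "C \<in> ?P"
      then obtain x where x: "x \<in> V" "C = set (cell_of x cells)"
        using cell by (auto simp: P)
      then have "cell_of x cells \<in> set cells"
        using cell_of_mem[of x cells] cells by (auto simp: component_list_def simp del: set_concat)
      then show "C \<in> set (map set cells)" using x(2) by simp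
    qed
  qed
  moreover have "oriented_list (contract_edges ?P E) (map (map_prod set set) ls)"
  proof -
    define es' where "es' = filter (\<lambda>(u, v). v \<notin> set (cell_of u cells)) es"
    define g where "g = (\<lambda>(u, v). {conn ?F `` {u}, conn ?F `` {v}})"
    have es': "(u, v) \<in> set es' \<longleftrightarrow> (u, v) \<in> set es \<and> (u, v) \<notin> conn ?F" for u v
      using cell[of u] esV[of u v] by (auto simp: es'_def)
    have map: "map und (map (map_prod set set) ls) = map g es'"
      using cell esV by (auto simp: ls links_eq es'_def g_def und_def)
    have "inj_on g (set es')"
    proof (rule inj_onI)
      fix e e' assume ee: "e \<in> set es'" "e' \<in> set es'" "g e = g e'"
      obtain a b a' b' where e: "e = (a, b)" "e' = (a', b')" by force
      have in_es: "(a, b) \<in> set es" "(a', b') \<in> set es" and diff: "(a, b) \<notin> conn ?F"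
        using ee es' e by auto
      have "(a, a') \<in> conn ?F \<and> (b, b') \<in> conn ?F \<or> (a, b') \<in> conn ?F \<and> (b, a') \<in> conn ?F"
        using ee(3) unfolding g_def e prod.case doubleton_eq_iff component_eq_iff .
      then have "{a, b} = {a', b'}"
      proof
        assume "(a, a') \<in> conn ?F \<and> (b, b') \<in> conn ?F"
        then show ?thesis
          using unique_edge_between_components[OF F esE[OF in_es(1)] esE[OF in_es(2)] _ _ diff] by simp
      next
        assume crossed: "(a, b') \<in> conn ?F \<and> (b, a') \<in> conn ?F"
        have "{b', a'} \<in> E" using esE[OF in_es(2)] by (simp add: insert_commute)
        then have "a = b' \<and> b = a'"
          using unique_edge_between_components[OF F esE[OF in_es(1)] _ _ _ diff] crossed by blast
        then show ?thesis by auto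
      qed
      then have "und e = und e'" by (simp add: e und_def)
      then show "e = e'"
        using es(1) in_es e by (auto simp: distinct_map dest: inj_onD)
    qed
    moreover have "distinct es'"
      using es(1) by (simp add: es'_def distinct_map)
    ultimately have "distinct (map g es')" by (simp add: distinct_map)
    moreover have "g ` set es' = contract_edges ?P E"
    proof
      show "g ` set es' \<subseteq> contract_edges ?P E"
      proof
        fix A assume "A \<in> g ` set es'"
        then obtain u v where uv: "(u, v) \<in> set es'" "A = {conn ?F `` {u}, conn ?F `` {v}}"
          by (auto simp: g_def)
        then have "(u, v) \<in> set es" "(u, v) \<notin> conn ?F" by (auto simp: es')
        then show "A \<in> contract_edges ?P E"
          unfolding uv(2) using contract_edges_iff[OF G FE] esV esE conn_refl by metis
      qed
      show "contract_edges ?P E \<subseteq> g ` set es'"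
      proof
        fix A assume A: "A \<in> contract_edges ?P E"
        then obtain X Y where XY: "X \<in> ?P" "Y \<in> ?P" "A = {X, Y}"
          unfolding contract_edges_def by blast
        then obtain x y where xy: "x \<in> V" "y \<in> V" "X = conn ?F `` {x}" "Y = conn ?F `` {y}"
          by (auto simp: P)
        then obtain a b where ab: "(x, y) \<notin> conn ?F" "(x, a) \<in> conn ?F" "(y, b) \<in> conn ?F" "{a, b} \<in> E"
          using contract_edges_iff[OF G FE xy(1,2)] A unfolding XY(3) xy(3,4) by blast
        then have eq: "X = conn ?F `` {a}" "Y = conn ?F `` {b}"
          using xy component_eq_iff by metis+
        have ncon: "(a, b) \<notin> conn ?F"
          using ab by (meson conn_sym conn_trans)
        obtain e where "e \<in> set es" "und e = {a, b}" using ab(4) es(2) by (metis imageE)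
        then have "(a, b) \<in> set es' \<or> (b, a) \<in> set es'"
          using ncon conn_sym[of b a ?F] by (cases e) (auto simp: es' und_def doubleton_eq_iff)
        then show "A \<in> g ` set es'"
          unfolding XY(3) eq by (force simp: g_def insert_commute)
      qed
    qed
    ultimately show ?thesis
      unfolding oriented_list_def using map by (metis list.set_map)
  qed
  ultimately show ?thesis by (simp add: represents_def)
qed

section \<open>Running time\<close>

lemma T_mem_le: "T_mem x ys \<le> length ys + 1"
  by (induction ys) auto

lemma T_cell_of_le: "T_cell_of x cs \<le> length (concat cs) + 2 * length cs + 1"
proof (induction cs)
  case (Cons c cs)
  then show ?case using T_mem_le[of x c] by auto
qed simp

lemma T_drop_cell_le: "T_drop_cell x cs \<le> length (concat cs) + 2 * length cs + 1"
proof (induction cs)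
  case (Cons c cs)
  then show ?case using T_mem_le[of x c] by auto
qed simp

lemma drop_cell_le:
  "length (concat (drop_cell x cs)) \<le> length (concat cs)" "length (drop_cell x cs) \<le> length cs"
  by (induction cs) auto

lemma length_cell_of_le: "length (cell_of x cs) \<le> length (concat cs)"
  by (induction cs) auto

lemma component_list_length:
  assumes "component_list V F cs"
  shows "length (concat cs) = card V" "length cs \<le> card V"
proof -
  show eq: "length (concat cs) = card V"
    using assms by (metis component_list_def distinct_card)
  have "[] \<notin> set cs" using assms by (simp add: component_list_def)
  then have "length cs \<le> length (concat cs)"
  proof (induction cs)
    case (Cons c cs)
    then show ?case by (cases c) auto
  qed simp
  with eq show "length cs \<le> card V" by simp
qed

text \<open>The cells partition the vertices and none is empty, so a pass through all of them takes time linear in the number of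
  vertices.\<close>

lemma T_sift_le:
  assumes "sift_inv V cs ts ks" "set es \<subseteq> V \<times> V"
  shows "T_sift cs es ts ks \<le> length es * (14 * card V + 7) + 1"
  using assms
proof (induction cs es ts ks rule: T_sift.induct)
  case (2 cs u v es ts ks)
  let ?n = "card V"
  have uv: "u \<in> V" "v \<in> V" using 2(4) by auto
  have cs: "length (concat cs) = ?n" "length cs \<le> ?n"
    using 2(3) component_list_length[of V "und ` set ts" cs] by (simp_all add: sift_inv_def)
  have c: "length (cell_of x cs) \<le> ?n" and T1: "T_cell_of x cs \<le> 3 * ?n + 1" "T_drop_cell x cs \<le> 3 * ?n + 1" for x
    using length_cell_of_le[of x cs] T_cell_of_le[of x cs] T_drop_cell_le[of x cs] cs by linarith+
  have T2: "T_drop_cell u (drop_cell v cs) \<le> 3 * ?n + 1"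
    using T_drop_cell_le[of u "drop_cell v cs"] drop_cell_le[of v cs] cs by linarith
  have T3: "T_mem v (cell_of u cs) \<le> ?n + 1" "T_append (cell_of u cs) (cell_of v cs) \<le> ?n + 1"
    using T_mem_le[of v "cell_of u cs"] c[of u] by (auto simp: T_append)
  show ?case
  proof (cases "v \<in> set (cell_of u cs)")
    case True
    have "T_sift cs es ts ((u, v) # ks) \<le> length es * (14 * ?n + 7) + 1"
      using 2(1)[OF refl] True sift_inv_cotree[OF 2(3) uv(1) True] 2(4) by simp
    then show ?thesis using T1(1)[of u] T3(1) True by (simp add: Let_def)
  next
    case False
    have "T_sift ((cell_of u cs @ cell_of v cs) # drop_cell u (drop_cell v cs)) es ((u, v) # ts) ks
        \<le> length es * (14 * ?n + 7) + 1"
      using 2(2)[OF refl] False sift_inv_tree[OF 2(3) uv False] 2(4) by simp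
    then show ?thesis using T1[of u] T1[of v] T2 T3 False by (simp add: Let_def)
  qed
qed simp

lemma T_set_at_le: "T_set_at k s x \<le> length x + 1"
  by (induction k s x rule: T_set_at.induct) auto

text \<open>Only an edge that is used up costs more than a constant, so the unused edges serve as credit.\<close>

lemma T_expand_le:
  assumes "length x \<le> N" "\<forall>(w, y)\<in>set work. length y \<le> N" "expand v x es work rest = (work', es')"
  shows "T_expand v x es work rest + (N + 1) * length es' \<le> 1 + length es + (N + 1) * (length es + length rest) \<and>
    length es' \<le> length es + length rest \<and> (\<forall>(w, y)\<in>set work'. length y \<le> N)"
  using assms
proof (induction v x es work rest rule: expand.induct)
  case (2 v x k a b es work rest)
  have T: "T_set_at k s x \<le> N + 1" for s
    using T_set_at_le[of k s x] 2(4) by linarith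
  consider (head) "a = v" | (tail) "a \<noteq> v" "b = v" | (none) "a \<noteq> v" "b \<noteq> v" by blast
  then show ?case
  proof cases
    case head
    then show ?thesis using 2(1)[OF head] 2(4-) T[of 1] by (auto simp: set_at_eq)
  next
    case tail
    then show ?thesis using 2(2)[OF tail] 2(4-) T[of "- 1"] by (auto simp: set_at_eq)
  next
    case none
    then show ?thesis using 2(3)[OF none] 2(4-) by auto
  qed
qed auto

lemma T_traverse_le:
  assumes "\<forall>(w, y)\<in>set work. length y \<le> N" "length es \<le> M"
  shows "T_traverse fuel work es \<le> length fuel * (M + 2) + (N + 1) * length es + 1"
  using assms
proof (induction fuel work es rule: T_traverse.induct)
  case (3 f fuel v x work es)
  obtain work' es' where ex: "expand v x es work [] = (work', es')" by force
  have ex': "T_expand v x es work [] + (N + 1) * length es' \<le> 1 + length es + (N + 1) * length es"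
      "length es' \<le> length es" "\<forall>(w, y)\<in>set work'. length y \<le> N"
    using T_expand_le[of x N work v es "[]" work' es'] 3(2) ex by auto
  have "T_traverse fuel work' es' \<le> length fuel * (M + 2) + (N + 1) * length es' + 1"
    using 3(1)[OF ex[symmetric]] ex' 3(3) by simp
  then show ?case using ex' 3(3) by (simp add: ex)
qed auto

lemma traverse_length:
  assumes "\<forall>(w, y)\<in>set work. length y \<le> N"
  shows "length (traverse fuel work es) \<le> length fuel \<and> (\<forall>(w, y)\<in>set (traverse fuel work es). length y \<le> N)"
  using assms
proof (induction fuel work es rule: traverse.induct)
  case (3 f fuel v x work es)
  obtain work' es' where ex: "expand v x es work [] = (work', es')" by force
  have "\<forall>(w, y)\<in>set work'. length y \<le> N"
    using T_expand_le[of x N work v es "[]" work' es'] 3(2) ex by auto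
  then show ?case using 3(1)[OF ex[symmetric]] 3(2) by (simp add: ex)
qed auto

lemma T_lookup_le: "T_lookup v ps \<le> length ps + 1"
  by (induction v ps rule: T_lookup.induct) auto

lemma lookup_length: "\<forall>(w, y)\<in>set ps. length y \<le> N \<Longrightarrow> length (lookup v ps) \<le> N"
  by (induction v ps rule: lookup.induct) auto

lemma T_diff_le: "T_diff xs ys \<le> length xs + 1"
  by (induction xs ys rule: T_diff.induct) auto

lemma T_columns_le:
  assumes "\<forall>(w, y)\<in>set ps. length y \<le> N" "length ps \<le> n"
  shows "T_columns ps ks \<le> length ks * (2 * n + N + 4) + 1"
  using assms
proof (induction ps ks rule: T_columns.induct)
  case (2 ps h t ks)
  have "T_lookup v ps \<le> n + 1" for v
    using T_lookup_le[of v ps] 2(3) by linarith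
  from this[of t] this[of h] have "T_lookup t ps \<le> n + 1" "T_lookup h ps \<le> n + 1" .
  moreover have "T_diff (lookup t ps) (lookup h ps) \<le> N + 1"
    using T_diff_le[of "lookup t ps" "lookup h ps"] lookup_length[OF 2(2), of t] by linarith
  ultimately show ?case using 2(1)[OF 2(2,3)] by simp
qed simp

lemma T_and_zero_le: "T_and_zero zs xs \<le> length zs + 1"
  by (induction zs xs rule: T_and_zero.induct) auto

lemma T_zero_flags_le: "length zs \<le> N \<Longrightarrow> T_zero_flags zs cs \<le> length cs * (N + 2) + 1"
proof (induction zs cs rule: T_zero_flags.induct)
  case (2 zs c cs)
  have "length (and_zero zs c) \<le> N" using 2(2) by (simp add: length_and_zero)
  then have "T_zero_flags (and_zero zs c) cs \<le> length cs * (N + 2) + 1" by (rule 2(1))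
  then show ?case using T_and_zero_le[of zs c] 2(2) by simp
qed simp

lemma T_flagged_le: "T_flagged es zs \<le> length es + 1"
  by (induction es zs rule: T_flagged.induct) auto

lemma T_links_le:
  assumes "component_list V F cs"
  shows "T_links cs es \<le> length es * (7 * card V + 4) + 1"
proof (induction es)
  case (Cons e es)
  obtain u v where e: "e = (u, v)" by force
  note cs = component_list_length[OF assms]
  have "T_cell_of x cs \<le> 3 * card V + 1" for x
    using T_cell_of_le[of x cs] cs by linarith
  from this[of u] this[of v] have "T_cell_of u cs \<le> 3 * card V + 1" "T_cell_of v cs \<le> 3 * card V + 1" .
  moreover have "T_mem v (cell_of u cs) \<le> card V + 1"
    using T_mem_le[of v "cell_of u cs"] length_cell_of_le[of u cs] cs by linarith
  ultimately show ?case using Cons by (auto simp: e Let_def)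
qed simp

lemma T_singletons_eq: "T_singletons vs = length vs + 1"
  by (induction vs) auto

lemma T_zeros_eq: "T_zeros es = length es + 1"
  by (induction es) auto

lemma T_number_eq: "T_number k es = length es + 1"
  by (induction es arbitrary: k) auto

lemma T_trues_eq: "T_trues es = length es + 1"
  by (induction es) auto

lemma T_tucker_columns_le:
  "T_tucker_columns vs ts ks \<le> length ts + 1 +
    (length ts + 1 + (length vs * (length ts + 2) + (length ts + 1) * length ts + 1)) +
    (length ks * (2 * length vs + length ts + 4) + 1)"
proof (cases vs)
  case (Cons v vs')
  let ?w = "[(v, zeros ts)]" and ?e = "number 0 ts"
  have w: "\<forall>(w, y)\<in>set ?w. length y \<le> length ts" by (simp add: zeros_eq)
  have "T_traverse vs ?w ?e \<le> length vs * (length ts + 2) + (length ts + 1) * length ts + 1"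
    using T_traverse_le[OF w, of ?e "length ts" vs] by simp
  moreover have "T_columns (traverse vs ?w ?e) ks \<le> length ks * (2 * length vs + length ts + 4) + 1"
    using traverse_length[OF w, of vs ?e] by (intro T_columns_le) auto
  moreover have "T_tucker_columns vs ts ks =
      T_zeros ts + (T_number 0 ts + T_traverse vs ?w ?e) + T_columns (traverse vs ?w ?e) ks"
    unfolding Cons by (rule T_tucker_columns.simps(2))
  ultimately show ?thesis
    unfolding T_zeros_eq T_number_eq by (metis add_mono order_refl)
qed simp

lemma T_choose_edges_le:
  assumes "fl = flagged ts (zero_flags (trues ts) M)" "length fl \<le> length ts"
  shows "T_choose_edges ts M q \<le> length M * (length ts + 2) + 4 * length ts + 6"
proof -
  have "T_zero_flags (trues ts) M \<le> length M * (length ts + 2) + 1"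
    by (rule T_zero_flags_le) (simp add: trues_eq)
  moreover have "T_flagged ts (zero_flags (trues ts) M) \<le> length ts + 1"
    by (rule T_flagged_le)
  ultimately show ?thesis
    using assms(2) unfolding T_choose_edges.simps Let_def assms(1)[symmetric] T_trues_eq T_length T_take
    by (auto simp: min_def)
qed

lemma T_contract_le:
  assumes "distinct vs" "set fs \<subseteq> set vs \<times> set vs"
  shows "T_contract vs es fs \<le> length vs + length fs * (14 * length vs + 7) + length es * (7 * length vs + 4) + 3"
proof -
  obtain ts ks cs where s: "sift (singletons vs) fs [] [] = (ts, ks, cs)" by (metis prod_cases3)
  have "T_sift (singletons vs) fs [] [] \<le> length fs * (14 * length vs + 7) + 1"
    using T_sift_le[OF sift_inv_initial[OF assms(1)] assms(2)] distinct_card[OF assms(1)] by simp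
  moreover have "T_links cs es \<le> length es * (7 * length vs + 4) + 1"
    using T_links_le[OF sift_components(4)[OF assms s]] distinct_card[OF assms(1)] by simp
  ultimately show ?thesis
    by (simp add: s T_singletons_eq)
qed

section \<open>Correctness of the algorithm\<close>

lemma represents_edges:
  assumes "simple_graph V E" "represents vs es V E"
  shows "set es \<subseteq> V \<times> V" "length es = card E" "length vs = card V"
proof -
  show "set es \<subseteq> V \<times> V"
  proof
    fix e assume e: "e \<in> set es"
    obtain a b where ab: "e = (a, b)" by force
    have "und e \<in> E" using e assms(2) by (auto simp: represents_def oriented_list_def)
    then show "e \<in> V \<times> V"
      using simple_graph_edge[OF assms(1), of a b] by (simp add: ab und_def)
  qed
  have "distinct (map und es)" "set (map und es) = E"
    using assms(2) by (auto simp: represents_def oriented_list_def)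
  then show "length es = card E" by (metis distinct_card length_map)
  show "length vs = card V"
    using assms(2) by (auto simp: represents_def distinct_card)
qed

lemma representation_exists:
  assumes "simple_graph V E"
  obtains vs es where "represents vs es V E"
proof -
  have "finite V" "finite E"
    using assms finite_subset[of E "Pow V"] by (auto simp: simple_graph_def)
  then obtain vs Es where vs: "distinct vs" "set vs = V" and Es: "distinct Es" "set Es = E"
    by (metis finite_distinct_list)
  have "\<forall>e\<in>E. \<exists>p. und p = e"
  proof
    fix e assume "e \<in> E"
    then obtain a b where "e = {a, b}" using simple_graph_edge_obtain[OF assms] by metis
    then show "\<exists>p. und p = e" by (intro exI[of _ "(a, b)"]) (simp add: und_def)
  qed
  then obtain g where g: "\<forall>e\<in>E. und (g e) = e" by metis
  then have "map und (map g Es) = Es" using Es(2) map_idI[of Es "und \<circ> g"] by simp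
  moreover from this have "und ` set (map g Es) = E" using Es(2) by (metis list.set_map)
  ultimately have "represents vs (map g Es) V E"
    unfolding represents_def oriented_list_def using vs Es by simp
  then show ?thesis by (rule that)
qed

lemma sift_spanning_tree:
  assumes G: "simple_graph V E" and C: "connected_graph V E" and rep: "represents vs es V E"
    and s: "sift (singletons vs) es [] [] = (ts, ks, cs)"
  defines "M \<equiv> tucker_columns vs ts ks"
  shows "steps_1_2 V E ts ks (mat_of_cols_list (length ts) M)"
    and "set ts \<union> set ks = set es" and "\<forall>c\<in>set M. length c = length ts"
    and "length ts + length ks = length es" and "length ts \<le> card V" and "distinct (map und ts)"
proof -
  let ?T = "und ` set ts"
  have vs: "distinct vs" "set vs = V" and es: "distinct (map und es)" "und ` set es = E"
    using rep by (auto simp: represents_def oriented_list_def)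
  note esV = represents_edges(1)[OF G rep]
  have esV': "set es \<subseteq> set vs \<times> set vs" using esV vs by simp
  note sift = sift_components[OF vs(1) esV' s]
  have inv: "simple_graph V ?T" "?T \<subseteq> bridges ?T" "length ts + length cs = card V"
    using sift(1) vs(2) by (auto simp: sift_inv_def)
  show set: "set ts \<union> set ks = set es"
    using mset_eq_setD[OF sift(2)] by simp
  show "length ts + length ks = length es"
    using mset_eq_length[OF sift(2)] by simp
  show "length ts \<le> card V" using inv(3) by simp
  have "mset (map und (ts @ ks)) = mset (map und es)"
    using sift(2) by (simp only: mset_map)
  from mset_eq_imp_distinct_iff[OF this]
  have dist: "distinct (map und (ts @ ks))" using es(1) by blast
  then show "distinct (map und ts)" by simp
  have "?T \<subseteq> E" using set es(2) by auto
  moreover have "connected_graph V ?T"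
    using C connected_graph_iff[OF G] connected_graph_iff[OF inv(1)] sift(3) es(2) by simp
  moreover have "simple_cycles V ?T = {}"
    using acyclic_iff_bridges[OF inv(1)] inv(2) by blast
  ultimately have T: "spanning_tree V E ?T"
    by (simp add: spanning_tree_def)
  have "und ` set ks = E - ?T"
    using dist set es(2) by auto
  then have ks: "oriented_list (E - ?T) ks" and ts: "oriented_list ?T ts"
    using dist by (auto simp: oriented_list_def)
  have ksV: "set ks \<subseteq> V \<times> V" using set esV by blast
  have M: "mat_of_cols_list (length ts) M = tucker V ts ks" "\<forall>c\<in>set M. length c = length ts"
    using tucker_columns_correct[OF G T _ ksV vs] dist unfolding M_def by simp_all
  then show "\<forall>c\<in>set M. length c = length ts" by simp
  show "steps_1_2 V E ts ks (mat_of_cols_list (length ts) M)"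
    unfolding steps_1_2_def using T ts ks M(1) by blast
qed

text \<open>In a connected graph with at least two vertices, every vertex is on an edge.\<close>

lemma card_vertices_le:
  assumes G: "simple_graph V E" and C: "connected_graph V E" and "1 < card V"
  shows "card V \<le> 2 * card E"
proof -
  have "V \<subseteq> \<Union> E"
  proof
    fix u assume u: "u \<in> V"
    have "V \<noteq> {u}" using assms(3) by auto
    then obtain v where v: "v \<in> V" "u \<noteq> v" using u by blast
    then have "(u, v) \<in> conn E" using C u connected_graph_iff[OF G] by blast
    then obtain w where "{u, w} \<in> E" using conn_first_edge[OF _ v(2)] by metis
    then show "u \<in> \<Union> E" by blast
  qed
  moreover have "finite (\<Union> E)"
    using G finite_subset[of "\<Union> E" V] by (auto simp: simple_graph_def)
  ultimately have "card V \<le> card (\<Union> E)" by (intro card_mono)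
  also have "\<dots> \<le> sum card E"
    by (rule card_Union_le_sum_card)
  also have "\<dots> = 2 * card E"
    using G by (simp add: simple_graph_def)
  finally show ?thesis .
qed

lemma reduce_correct:
  assumes G: "simple_graph V E" and C: "connected_graph V E" and rep: "represents vs es V E"
  shows "case reduce vs es r of (ts, ks, tcs, res) \<Rightarrow>
        steps_1_2 V E ts ks (mat_of_cols_list (length ts) tcs) \<and>
        set ts \<union> set ks = set es \<and>
        (\<forall>tc\<in>set tcs. length tc = length ts) \<and>
        (case res of
           None \<Rightarrow> \<not> (\<exists>Ecs. solution V E r Ecs)
         | Some (fs, cells, ls) \<Rightarrow>
             (let Ecs = und ` set fs; P = edge_partition V Ecs in
              step_3 (card V - r) ts (mat_of_cols_list (length ts) tcs) Ecs \<and>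
              solution V E r Ecs \<and>
              represents (map set cells) (map (map_prod set set) ls) P (contract_edges P E)))"
proof -
  obtain ts ks cs where s: "sift (singletons vs) es [] [] = (ts, ks, cs)" by (metis prod_cases3)
  define M where "M = tucker_columns vs ts ks"
  define fl where "fl = flagged ts (zero_flags (trues ts) M)"
  define q where "q = card V - r"
  note tree = sift_spanning_tree[OF G C rep s, folded M_def]
  note rows = chosen_rows[OF tree(3), folded fl_def]
  have fl: "und ` set fl = bridges E" "distinct (map und fl)"
    using rows zero_rows_eq_bridges[OF G tree(1)] tree(6) by auto
  have card_fl: "card (bridges E) = length fl"
    using fl by (metis distinct_card length_map list.set_map)
  have fin: "finite (bridges E)" using fl(1) by (metis List.finite_set finite_imageI)
  define res where "res = (case choose_edges ts M q of None \<Rightarrow> None | Some fs \<Rightarrow> Some (fs, contract vs es fs))"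
  have red: "reduce vs es r = (ts, ks, M, res)"
    using represents_edges(3)[OF G rep] by (simp add: s M_def q_def res_def Let_def)
  have choose: "choose_edges ts M q = (if length fl < q then None else Some (take q fl))"
    by (simp add: fl_def Let_def)
  have sol: "step_3 (card V - r) ts (mat_of_cols_list (length ts) M) F \<longleftrightarrow> solution V E r F"
      "solution V E r F \<longleftrightarrow> F \<subseteq> bridges E \<and> card F = q" for F
    using step_3_iff_solution[OF G tree(1)] zero_rows_eq_bridges[OF G tree(1)]
    by (auto simp: step_3_def q_def)
  have "case res of
           None \<Rightarrow> \<not> (\<exists>Ecs. solution V E r Ecs)
         | Some (fs, cells, ls) \<Rightarrow>
             (let Ecs = und ` set fs; P = edge_partition V Ecs in
              step_3 (card V - r) ts (mat_of_cols_list (length ts) M) Ecs \<and>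
              solution V E r Ecs \<and>
              represents (map set cells) (map (map_prod set set) ls) P (contract_edges P E))"
  proof (cases "length fl < q")
    case True
    then have "\<not> solution V E r F" for F
      using card_mono[OF fin, of F] card_fl sol(2) by auto
    then show ?thesis using True by (simp only: res_def choose) simp
  next
    case False
    let ?fs = "take q fl"
    obtain cells ls where c: "contract vs es ?fs = (cells, ls)" by force
    have res: "res = Some (?fs, cells, ls)"
      using False c unfolding res_def choose by simp
    have F: "und ` set ?fs \<subseteq> bridges E"
      using fl(1) set_take_subset[of q fl] by blast
    have "distinct (map und ?fs)" using fl(2) by (simp flip: take_map)
    then have "card (und ` set ?fs) = q"
      using False by (metis distinct_card length_map length_take list.set_map min.absorb2 not_less)
    then have "solution V E r (und ` set ?fs)" using sol(2) F by blast
    moreover have "set ?fs \<subseteq> set es"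
      using set_take_subset[of q fl] flagged_subset[of ts] tree(2) unfolding fl_def by blast
    ultimately show ?thesis
      using contract_represents[OF G rep _ F c] sol(1) unfolding res by (simp add: Let_def)
  qed
  with tree(1,2,3) show ?thesis
    unfolding red prod.case by blast
qed

lemma T_reduce_le:
  assumes G: "simple_graph V E" and C: "connected_graph V E" and rep: "represents vs es V E"
    and n: "1 < card V"
  shows "T_reduce vs es r \<le> 100 * (card E * card V)"
proof -
  obtain ts ks cs where s: "sift (singletons vs) es [] [] = (ts, ks, cs)" by (metis prod_cases3)
  define M where "M = tucker_columns vs ts ks"
  define fl where "fl = flagged ts (zero_flags (trues ts) M)"
  define n m p k q where "n = length vs" and "m = length es" and "p = length ts" and "k = length ks"
    and "q = n - r"
  note tree = sift_spanning_tree[OF G C rep s, folded M_def]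
  note len = represents_edges[OF G rep]
  have vs: "distinct vs" "set vs = V" using rep by (auto simp: represents_def)
  have esV: "set es \<subseteq> set vs \<times> set vs" using len(1) vs(2) by simp
  have p: "p \<le> n" "p \<le> m" "k \<le> m"
    using tree(4,5) len by (auto simp: n_def m_def p_def k_def)
  have pos: "1 \<le> n" "1 \<le> m"
    using n card_vertices_le[OF G C n] len by (auto simp: n_def m_def)
  have lenM: "length M \<le> k"
    unfolding M_def k_def by (cases vs) (auto simp: columns_eq)
  have fl: "length fl \<le> p" "set fl \<subseteq> set es"
    using chosen_rows(3)[OF tree(3)] flagged_subset[of ts] tree(2) unfolding fl_def p_def by blast+
  \<comment> \<open>Every summand of the running time is bounded by a multiple of \<open>P\<close>.\<close>
  define P where "P = m * n"
  have P: "n \<le> P" "m \<le> P" "1 \<le> P" "n * p \<le> P" "p * p \<le> P" "k * n \<le> P" "k * p \<le> P"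
    unfolding P_def using pos p by (auto intro: mult_le_mono order_trans[OF _ mult_le_mono] simp: mult.commute[of n p])
  then have P': "p \<le> P" "k \<le> P"
    using p by linarith+
  have 1: "T_sift (singletons vs) es [] [] \<le> 14 * P + 7 * m + 1"
    using T_sift_le[OF sift_inv_initial[OF vs(1)] esV] distinct_card[OF vs(1)]
    by (simp add: P_def m_def n_def algebra_simps)
  have 2: "T_tucker_columns vs ts ks \<le> 2 * p + 2 + (n * p + 2 * n + p * p + p + 1) + (2 * (k * n) + k * p + 4 * k + 1)"
    using T_tucker_columns_le[of vs ts ks] by (simp add: p_def n_def k_def algebra_simps)
  have "length M * (p + 2) \<le> k * p + 2 * k"
    using mult_le_mono1[OF lenM, of "p + 2"] by (simp add: algebra_simps)
  then have 3: "T_choose_edges ts M q \<le> k * p + 2 * k + 4 * p + 6"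
    using T_choose_edges_le[OF fl_def, of q] fl(1) unfolding p_def by linarith
  have 4: "T_contract vs es fs \<le> n + 14 * P + 7 * P + 7 * P + 4 * m + 3"
    if "choose_edges ts M q = Some fs" for fs
  proof -
    have fs: "fs = take q fl" using that by (auto simp: fl_def Let_def split: if_splits)
    then have "set fs \<subseteq> set vs \<times> set vs" using fl(2) esV set_take_subset[of q fl] by blast
    from T_contract_le[OF vs(1) this, of es]
    have "T_contract vs es fs \<le> n + length fs * (14 * n + 7) + (7 * P + 4 * m) + 3"
      by (simp add: n_def m_def P_def algebra_simps)
    moreover have "length fs * (14 * n + 7) \<le> p * (14 * n + 7)"
      by (rule mult_le_mono1) (use fs fl(1) in simp)
    moreover have "p * (14 * n + 7) = 14 * (n * p) + 7 * p" by (simp add: algebra_simps)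
    ultimately show ?thesis using P P' by linarith
  qed
  have "T_reduce vs es r = n + 1 + T_sift (singletons vs) es [] [] + (T_tucker_columns vs ts ks +
      (n + 1 + T_choose_edges ts M q +
        (case choose_edges ts M q of None \<Rightarrow> 0 | Some fs \<Rightarrow> T_contract vs es fs)))"
    by (simp add: s M_def n_def q_def T_singletons_eq T_length Let_def del: T_choose_edges.simps choose_edges.simps)
  also have "\<dots> \<le> 100 * P"
    using 1 2 3 4 P P' by (cases "choose_edges ts M q") simp_all
  finally show ?thesis using len by (simp add: P_def n_def m_def)
qed

theorem mainTheorem4:
  "(\<forall>(V :: 'a set) E r.
      simple_graph V E \<and> connected_graph V E \<and> 1 \<le> r \<and> r < card V \<longrightarrow>
      (\<exists>ts ks M. steps_1_2 V E ts ks M) \<and>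
      (\<forall>ts ks M. steps_1_2 V E ts ks M \<longrightarrow>
        (\<forall>Ecs. step_3 (card V - r) ts M Ecs \<longrightarrow> solution V E r Ecs) \<and>
        ((\<exists>Ecs. solution V E r Ecs) \<longrightarrow> (\<exists>Ecs. step_3 (card V - r) ts M Ecs)))) \<and>
   (\<exists>c :: nat. \<forall>(V :: 'a set) E r vs es.
      simple_graph V E \<and> connected_graph V E \<and> 1 \<le> r \<and> r < card V \<and> represents vs es V E \<longrightarrow>
      T_reduce vs es r \<le> c * (card E * card V) \<and>
      (case reduce vs es r of (ts, ks, tcs, res) \<Rightarrow>
        steps_1_2 V E ts ks (mat_of_cols_list (length ts) tcs) \<and>
        set ts \<union> set ks = set es \<and>
        (\<forall>tc\<in>set tcs. length tc = length ts) \<and>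
        (case res of
           None \<Rightarrow> \<not> (\<exists>Ecs. solution V E r Ecs)
         | Some (fs, cells, ls) \<Rightarrow>
             (let Ecs = und ` set fs; P = edge_partition V Ecs in
              step_3 (card V - r) ts (mat_of_cols_list (length ts) tcs) Ecs \<and>
              solution V E r Ecs \<and>
              represents (map set cells) (map (map_prod set set) ls) P (contract_edges P E)))))"
proof (intro conjI allI impI, goal_cases)
  case (1 V E r)
  then have G: "simple_graph V E" and C: "connected_graph V E" by auto
  obtain vs es where rep: "represents vs es V E"
    using representation_exists[OF G] .
  obtain ts ks cs where "sift (singletons vs) es [] [] = (ts, ks, cs)"
    by (metis prod_cases3)
  from sift_spanning_tree(1)[OF G C rep this] show ?case by blast
next
  case (2 V E r ts ks M Ecs)
  then show ?case using step_3_iff_solution[of V E ts ks M r Ecs] by blast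
next
  case (3 V E r ts ks M)
  then show ?case using step_3_iff_solution[of V E ts ks M r] by blast
next
  case 4
  show ?case
  proof (intro exI[of _ 100] allI impI conjI, goal_cases)
    case (1 V E r vs es)
    then show ?case by (intro T_reduce_le) auto
  next
    case (2 V E r vs es)
    then show ?case by (intro reduce_correct) auto
  qed
qed

end
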